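(* Let $A=\{0,1,\ldots,j\}$ be a finite alphabet with at least two letters and let $\{\phi_i\}_{i\in A}$ be a conformal iterated function system (CIFS) with alphabet $A$. For $\beta\in[0,j+1]$ let $X_\beta\subset A^{\mathbb{N}}$ be the $\beta$-shift and let $J(X_\beta)=\pi(X_\beta)$ be the associated limit set. Then the function $\beta\mapsto HD(J(X_\beta))$ is continuous on $[0,j+1]$, where $HD$ denotes Hausdorff dimension.
   Context: **Symbolic notation.** $A^{\mathbb{N}}$ is the set of sequences $x=(x_1,x_2,\ldots)$ with $x_i\in A$, with the product of the discrete topology. The left shift is $\sigma(x_1,x_2,\ldots)=(x_2,x_3,\ldots)$. A subshift over $A$ is a closed set $X\subset A^{\mathbb{N}}$ with $x\in X\Rightarrow\sigma x\in X$. **CIFS.** A conformal iterated function system with alphabet $A$ (with at least two letters) consists of a non-empty compact set $Y\subset\mathbb{R}^d$ ($d\ge1$) and one-to-one contractions $\phi_e:Y\to Y$, $e\in A$, whose contraction ratios are all at most some $s\in(0,1)$, such that: (i) $Y$ is connected and $Y=\overline{\mathrm{Int}_{\mathbb{R}^d}(Y)}$; (ii) (Open Set Condition) $\phi_e(\mathrm{Int}(Y))\cap\phi_f(\mathrm{Int}(Y))=\emptyset$ for all $e\neq f$ in $A$; (iii) for every $f\in A$ there is a connected open set $W_f$ with $Y\subseteq W_f\subseteq\mathbb{R}^d$ such that $\phi_f$ extends to a $C^1$ conformal diffeomorphism of $W_f$ into $\bigcap_{e\in A}W_e$; (iv) there are constants $L\ge1$, $\alpha>0$ such that $\bigl||\phi_e'(x)|-|\phi_e'(y)|\bigr|\le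 L\,\|(\phi_e')^{-1}\|^{-1}\,|x-y|^\alpha$ for all $e\in A$ and $x,y\in Y$, where $|\phi_e'(x)|$ is the norm of the derivative at $x$ and $\|(\phi_e')^{-1}\|$ is the supremum over $Y$ of the norm of the inverse of the derivative; (v) (Cone Property) there exist $\gamma,l>0$, $\gamma<\pi/2$, such that for every $x\in Y$ there is an open cone $\mathrm{Con}(x,\gamma,l)\subseteq\mathrm{Int}(Y)$ with vertex $x$, central angle $\gamma$ and altitude $l$. **Limit sets.** The coding map $\pi:A^{\mathbb{N}}\to Y$ is defined by $\{\pi(\omega)\}=\bigcap_{n\ge1}\phi_{\omega_1}\circ\cdots\circ\phi_{\omega_n}(Y)$ (the intersection is a singleton). For a subshift $X\subset A^{\mathbb{N}}$, its limit set is $J(X)=\pi(X)$. **$\beta$-shifts.** For $\beta>1$, $X_\beta$ is the subshift over the alphabet $\{0,1,\ldots,\lceil\beta\rceil-1\}$ consisting of all sequences $x$ such that for all integers $0\le i<m$, $\sum_{s=1}^{m-i}\frac{x_{s+i}}{\beta^s}<1$. (Equivalently, it is the closure of the set of greedy base-$\beta$ expansions of numbers in $[0,1)$.) For $\beta\le1$, $X_\beta=\{0^\infty\}$, where $0^\infty=(0,0,\ldots)$. *)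

theory Defs
  imports "HOL-Analysis.Analysis"
begin

section \<open>Hausdorff dimension\<close>

text \<open>
  The \<open>s\<close>-th power of the diameter, with the conventions of Hausdorff measure: the empty
  set contributes \<open>0\<close> and, for \<open>s = 0\<close>, every non-empty set contributes \<open>1\<close> (whereas
  \<open>0 powr 0 = 0\<close> in the library). Only used for bounded sets, since \<^const>\<open>diameter\<close> is
  unspecified on unbounded ones.
\<close>

definition diam_pow :: "real \<Rightarrow> 'a::metric_space set \<Rightarrow> ennreal" where
  "diam_pow s U = (if U = {} then 0 else if s = 0 then 1 else ennreal (diameter U powr s))"

definition hausdorff_premeasure :: "real \<Rightarrow> real \<Rightarrow> 'a::metric_space set \<Rightarrow> ennreal" where
  "hausdorff_premeasure s \<delta> S =
     (INF U \<in> {U :: nat \<Rightarrow> 'a set. S \<subseteq> (\<Union>i. U i) \<and> (\<forall>i. bounded (U i) \<and> diameter (U i) \<le> \<delta>)}.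
        \<Sum>i. diam_pow s (U i))"

definition hausdorff_measure :: "real \<Rightarrow> 'a::metric_space set \<Rightarrow> ennreal" where
  "hausdorff_measure s S = (SUP \<delta> \<in> {0<..}. hausdorff_premeasure s \<delta> S)"

text \<open>
  In a Euclidean space every \<open>s > DIM('a)\<close> has vanishing \<open>s\<close>-dimensional measure, so the
  infimum below is over a non-empty set of non-negative reals.
\<close>

definition hausdorff_dim :: "'a::euclidean_space set \<Rightarrow> real" where
  "hausdorff_dim S = Inf {s. 0 \<le> s \<and> hausdorff_measure s S = 0}"

section \<open>Conformal iterated function systems\<close>

definition C1_on :: "'a::real_normed_vector set \<Rightarrow> ('a \<Rightarrow> 'b::real_normed_vector) \<Rightarrow> bool" where
  "C1_on W f \<longleftrightarrow> open W \<and>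
     (\<exists>D :: 'a \<Rightarrow> 'a \<Rightarrow>\<^sub>L 'b. (\<forall>x\<in>W. (f has_derivative blinfun_apply (D x)) (at x)) \<and> continuous_on W D)"

definition C1_diffeo_on :: "'a::real_normed_vector set \<Rightarrow> ('a \<Rightarrow> 'b::real_normed_vector) \<Rightarrow> bool" where
  "C1_diffeo_on W f \<longleftrightarrow> inj_on f W \<and> C1_on W f \<and> C1_on (f ` W) (inv_into W f)"

text \<open>
  Conformality: each derivative is a similarity. Orientation-reversing maps are allowed.
\<close>

definition conformal_on :: "'a::euclidean_space set \<Rightarrow> ('a \<Rightarrow> 'a) \<Rightarrow> bool" where
  "conformal_on W f \<longleftrightarrow>
     (\<forall>x\<in>W. \<exists>c>0. \<exists>T. orthogonal_transformation T \<and> (f has_derivative (\<lambda>v. c *\<^sub>R T v)) (at x))"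

text \<open>
  The open cone with vertex \<open>x\<close>, axis in the direction of the unit vector \<open>u\<close>, central angle
  (full aperture) \<open>\<gamma>\<close> and altitude \<open>l\<close>.
\<close>

definition open_cone :: "'a::euclidean_space \<Rightarrow> 'a \<Rightarrow> real \<Rightarrow> real \<Rightarrow> 'a set" where
  "open_cone x u \<gamma> l =
     {y. 0 < (y - x) \<bullet> u \<and> (y - x) \<bullet> u < l \<and> cos (\<gamma> / 2) * norm (y - x) < (y - x) \<bullet> u}"

text \<open>
  The maps are total functions of which only the values on \<open>Y\<close> matter. The derivative
  of \<open>\<phi> e\<close> at a point of \<open>Y\<close> is that of its extension \<open>\<Phi> e\<close>; it does not depend on
  the extension, because the extension is \<open>C\<^sup>1\<close> and \<open>Y\<close> is the closure of its interior.
\<close>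

locale CIFS =
  fixes A :: "'i set" and Y :: "'a::euclidean_space set" and \<phi> :: "'i \<Rightarrow> 'a \<Rightarrow> 'a"
  assumes two_letters: "\<exists>a\<in>A. \<exists>b\<in>A. a \<noteq> b"
    and compact: "compact Y" and nonempty: "Y \<noteq> {}"
    and maps_to: "\<forall>e\<in>A. \<phi> e ` Y \<subseteq> Y"
    and one_to_one: "\<forall>e\<in>A. inj_on (\<phi> e) Y"
    and contraction: "\<exists>s. 0 < s \<and> s < 1 \<and> (\<forall>e\<in>A. lipschitz_on s Y (\<phi> e))"
    and connected: "connected Y"
    and regular_closed: "Y = closure (interior Y)"
    and open_set_condition:
      "\<forall>e\<in>A. \<forall>f\<in>A. e \<noteq> f \<longrightarrow> \<phi> e ` interior Y \<inter> \<phi> f ` interior Y = {}"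
    and conformal_extension:
      "\<exists>(W :: 'i \<Rightarrow> 'a set) (\<Phi> :: 'i \<Rightarrow> 'a \<Rightarrow> 'a).
         (\<forall>f\<in>A. connected (W f) \<and> open (W f) \<and> Y \<subseteq> W f \<and> (\<forall>x\<in>Y. \<Phi> f x = \<phi> f x) \<and>
            C1_diffeo_on (W f) (\<Phi> f) \<and> conformal_on (W f) (\<Phi> f) \<and>
            \<Phi> f ` W f \<subseteq> (\<Inter>e\<in>A. W e)) \<and>
         (\<exists>L \<alpha>. 1 \<le> L \<and> 0 < \<alpha> \<and>
            (\<forall>e\<in>A. \<forall>x\<in>Y. \<forall>y\<in>Y.
               \<bar>onorm (frechet_derivative (\<Phi> e) (at x)) - onorm (frechet_derivative (\<Phi> e) (at y))\<bar>
                 \<le> L * inverse (SUP z\<in>Y. onorm (inv (frechet_derivative (\<Phi> e) (at z))))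
                     * dist x y powr \<alpha>))"
    and cone_property:
      "\<exists>\<gamma> l. 0 < \<gamma> \<and> \<gamma> < pi / 2 \<and> 0 < l \<and>
         (\<forall>x\<in>Y. \<exists>u. norm u = 1 \<and> open_cone x u \<gamma> l \<subseteq> interior Y)"

text \<open>
  A sequence \<open>(\<omega>\<^sub>1, \<omega>\<^sub>2, \<dots>)\<close> is represented by the function whose value at \<open>n\<close> is the entry
  with index \<open>n + 1\<close>.
\<close>

fun word_map :: "('i \<Rightarrow> 'a \<Rightarrow> 'a) \<Rightarrow> (nat \<Rightarrow> 'i) \<Rightarrow> nat \<Rightarrow> 'a \<Rightarrow> 'a" where
  "word_map \<phi> \<omega> 0 = id"
| "word_map \<phi> \<omega> (Suc n) = word_map \<phi> \<omega> n \<circ> \<phi> (\<omega> n)"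

definition coding_map :: "'a set \<Rightarrow> ('i \<Rightarrow> 'a \<Rightarrow> 'a) \<Rightarrow> (nat \<Rightarrow> 'i) \<Rightarrow> 'a" where
  "coding_map Y \<phi> \<omega> = the_elem (\<Inter>n\<in>{1..}. word_map \<phi> \<omega> n ` Y)"

definition limit_set :: "'a set \<Rightarrow> ('i \<Rightarrow> 'a \<Rightarrow> 'a) \<Rightarrow> (nat \<Rightarrow> 'i) set \<Rightarrow> 'a set" where
  "limit_set Y \<phi> X = coding_map Y \<phi> ` X"

section \<open>Beta-shifts\<close>

text \<open>The entry \<open>x\<^sub>k\<close> is \<open>x (k - 1)\<close>; below \<open>k = s + i \<ge> 1\<close>.\<close>

definition beta_shift :: "real \<Rightarrow> (nat \<Rightarrow> nat) set" where
  "beta_shift \<beta> =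
     (if \<beta> \<le> 1 then {\<lambda>_. 0}
      else {x. (\<forall>n. int (x n) \<le> \<lceil>\<beta>\<rceil> - 1) \<and>
               (\<forall>i m. i < m \<longrightarrow> (\<Sum>s = 1..m - i. real (x (s + i - 1)) / \<beta> ^ s) < 1)})"

end

theory Submission
  imports Defs "HOL-Library.Sublist"
begin

text \<open>
  Up to the bounded distortion constant, the weight \<open>\<psi>(w)\<close> of a word \<open>w\<close> is the norm of the
  derivative of \<open>\<phi>\<^sub>w\<close>. It is multiplicative up to a constant, and \<open>\<phi>\<^sub>w(Y)\<close> has diameter at most
  a constant times \<open>\<psi>(w)\<close> and contains a ball of radius comparable to \<open>\<psi>(w)\<close>. For a subshift \<open>X\<close>
  let \<open>Z\<^sub>n(X, t)\<close> be the sum of \<open>\<psi>(w)\<^sup>t\<close> over the words of length \<open>n\<close> of \<open>X\<close>. If \<open>Z\<^sub>n(X, t) < 1\<close>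
  for some \<open>n \<ge> 1\<close>, the sets \<open>\<phi>\<^sub>w(Y)\<close> show that the \<open>t\<close>-dimensional measure of \<open>J(X)\<close> vanishes.
  Conversely, if \<open>HD(J(X)) < t\<close>, a volume argument turns a cover of \<open>J(X)\<close> with small sum into a
  finite cover of \<open>X\<close> by cylinders with small sum of \<open>\<psi>\<^sup>t\<close>; cutting words of \<open>X\<close> successively along
  this cover shows that \<open>Z\<^sub>n(X, t)\<close> decays exponentially.

  For \<open>\<beta>\<close>-shifts, decrementing the last non-zero letter of a word of length \<open>n\<close> changes the
  weight by a bounded factor, is at most \<open>(n + 1)\<close>-to-one, makes words freely concatenable, and turns
  words all of whose tails have value \<open>\<le> 1\<close> into words all of whose tails have value \<open>< 1\<close>.
  The last property bounds \<open>Z\<^sub>n(X\<^bsub>\<beta>'\<^esub>, t)\<close> by \<open>Z\<^sub>n(X\<^bsub>\<beta>\<^esub>, t)\<close> for \<open>\<beta>'\<close> slightly above \<open>\<beta>\<close>, and free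
  concatenation bounds \<open>Z\<^sub>n(X\<^bsub>\<beta>'\<^esub>, t)\<close> from below for \<open>\<beta>'\<close> slightly below \<open>\<beta>\<close>.
\<close>

section \<open>Hausdorff measure and dimension\<close>

lemma diam_pow_pos: "0 < t \<Longrightarrow> diam_pow t U = ennreal (diameter U powr t)"
  by (auto simp: diam_pow_def)

lemma hausdorff_premeasure_le_finite:
  assumes "0 < t" "finite I" "S \<subseteq> (\<Union>i\<in>I. U i)" "0 \<le> \<delta>"
    and U: "\<And>i. i \<in> I \<Longrightarrow> bounded (U i) \<and> diameter (U i) \<le> \<delta>"
  shows "hausdorff_premeasure t \<delta> S \<le> ennreal (\<Sum>i\<in>I. diameter (U i) powr t)"
proof -
  obtain h where h: "bij_betw h {0..<card I} I"
    using ex_bij_betw_nat_finite[OF \<open>finite I\<close>] by blast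
  \<comment> \<open>Padding with the empty set turns a finite cover into a sequence at no cost,
    since \<open>diam_pow\<close> vanishes on it.\<close>
  define V where "V k = (if k < card I then U (h k) else {})" for k
  have hI: "h k \<in> I" if "k < card I" for k
    using h that by (auto simp: bij_betw_def)
  have "S \<subseteq> (\<Union>k. V k)"
  proof
    fix x assume "x \<in> S"
    then obtain i where "i \<in> I" "x \<in> U i" using assms by auto
    then obtain k where "k < card I" "h k = i"
      using h by (metis atLeastLessThan_iff bij_betw_def imageE)
    then show "x \<in> (\<Union>k. V k)" using \<open>x \<in> U i\<close> by (auto simp: V_def)
  qed
  moreover have "bounded (V k) \<and> diameter (V k) \<le> \<delta>" for k
    using U hI \<open>0 \<le> \<delta>\<close> by (auto simp: V_def)
  ultimately have "hausdorff_premeasure t \<delta> S \<le> (\<Sum>k. diam_pow t (V k))"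
    unfolding hausdorff_premeasure_def by (intro INF_lower) auto
  also have "\<dots> = (\<Sum>k\<in>{0..<card I}. diam_pow t (V k))"
    by (rule suminf_finite) (auto simp: V_def diam_pow_def)
  also have "\<dots> = (\<Sum>k\<in>{0..<card I}. ennreal (diameter (U (h k)) powr t))"
    using \<open>0 < t\<close> by (intro sum.cong) (auto simp: V_def diam_pow_pos)
  also have "\<dots> = (\<Sum>i\<in>I. ennreal (diameter (U i) powr t))"
    by (rule sum.reindex_bij_betw[OF h])
  also have "\<dots> = ennreal (\<Sum>i\<in>I. diameter (U i) powr t)"
    by (rule sum_ennreal) simp
  finally show ?thesis .
qed

text \<open>The index type \<open>'b\<close> is left free so that covers can be indexed by
  words.\<close>

lemma hausdorff_measure_eq_0I:
  assumes "0 < t"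
    and cover: "\<And>\<delta> \<epsilon>. 0 < \<delta> \<Longrightarrow> 0 < \<epsilon> \<Longrightarrow> \<exists>I U. finite (I :: 'b set) \<and> S \<subseteq> (\<Union>i\<in>I. U i)
      \<and> (\<forall>i\<in>I. bounded (U i) \<and> diameter (U i) \<le> \<delta>) \<and> (\<Sum>i\<in>I. diameter (U i) powr t) \<le> \<epsilon>"
  shows "hausdorff_measure t S = 0"
proof -
  have "hausdorff_premeasure t \<delta> S \<le> 0" if \<delta>: "0 < \<delta>" for \<delta>
  proof (rule ennreal_le_epsilon)
    fix \<epsilon> :: real assume "0 < \<epsilon>"
    then obtain I :: "'b set" and U where IU: "finite I" "S \<subseteq> (\<Union>i\<in>I. U i)"
      "\<forall>i\<in>I. bounded (U i) \<and> diameter (U i) \<le> \<delta>" "(\<Sum>i\<in>I. diameter (U i) powr t) \<le> \<epsilon>"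
      using cover[OF \<delta>] by blast
    then show "hausdorff_premeasure t \<delta> S \<le> 0 + ennreal \<epsilon>"
      using hausdorff_premeasure_le_finite[OF \<open>0 < t\<close>, of I S U \<delta>] \<delta>
      by (auto intro: order_trans ennreal_leI)
  qed
  then have "hausdorff_measure t S \<le> 0"
    unfolding hausdorff_measure_def by (intro SUP_least) auto
  then show ?thesis by simp
qed

text \<open>A strictly larger exponent absorbs the convention for \<open>s = 0\<close>: there the
  right-hand side is 1 for a non-empty set, and diameter at most 1 keeps the left-hand side from
  exceeding it.\<close>

lemma diameter_powr_le_diam_pow:
  assumes "0 \<le> s" "s < t" "bounded U" "diameter U \<le> 1"
  shows "ennreal (diameter U powr t) \<le> diam_pow s U"
proof -
  have d: "0 \<le> diameter U" using diameter_ge_0[OF \<open>bounded U\<close>] .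
  consider "U = {}" | "U \<noteq> {}" "s = 0" | "U \<noteq> {}" "0 < s" using assms by linarith
  then show ?thesis
  proof cases
    case 2
    then show ?thesis using assms d by (auto simp: diam_pow_def powr_le1 ennreal_le_1)
  next
    case 3
    then have "diameter U powr t \<le> diameter U powr s"
      using assms d by (intro powr_mono') auto
    then show ?thesis using 3 by (auto simp: diam_pow_def intro: ennreal_leI)
  qed (use assms in \<open>auto simp: diam_pow_def\<close>)
qed

text \<open>Covering sets may have diameter 0, whereas stopping words exist only at positive scales.
  Hence each diameter is enlarged to a positive \<open>r i\<close>, at a total cost of
  \<epsilon>/2.\<close>

lemma null_set_cover:
  assumes null: "hausdorff_measure s S = 0" and "0 \<le> s" "s < t" "0 < \<delta>" "0 < \<epsilon>"
  obtains U :: "nat \<Rightarrow> 'a::metric_space set" and r :: "nat \<Rightarrow> real"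
  where "S \<subseteq> (\<Union>i. U i)" "\<And>i. bounded (U i)" "\<And>i. diameter (U i) \<le> r i"
    "\<And>i. 0 < r i" "\<And>i. r i < \<delta>" "\<And>I. finite I \<Longrightarrow> (\<Sum>i\<in>I. r i powr t) \<le> \<epsilon>"
proof -
  define \<delta>' where "\<delta>' = min 1 (\<delta> / 2)"
  have "\<delta>' \<in> {0<..}" using assms by (auto simp: \<delta>'_def)
  then have "hausdorff_premeasure s \<delta>' S \<le> hausdorff_measure s S"
    unfolding hausdorff_measure_def by (rule SUP_upper)
  then have "hausdorff_premeasure s \<delta>' S < ennreal (\<epsilon> / 2)"
    using null \<open>0 < \<epsilon>\<close> by auto
  then obtain U where U: "S \<subseteq> (\<Union>i. U i)" "\<And>i. bounded (U i)" "\<And>i. diameter (U i) \<le> \<delta>'"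
    and sum: "(\<Sum>i. diam_pow s (U i)) < ennreal (\<epsilon> / 2)"
    unfolding hausdorff_premeasure_def INF_less_iff by blast
  \<comment> \<open>\<open>q i powr t\<close> stays below the terms of a geometric series with sum
    \<epsilon>/2; the cap \<delta>/2 keeps \<open>r i\<close> below \<delta>.\<close>
  define q where "q i = min (\<delta> / 2) ((\<epsilon> / 2 * (1 / 2) ^ Suc i) powr (1 / t))" for i
  define r where "r i = max (diameter (U i)) (q i)" for i
  have "0 < t" using assms by linarith
  have q: "0 < q i" for i using assms by (auto simp: q_def)
  have qt: "q i powr t \<le> \<epsilon> / 2 * (1 / 2) ^ Suc i" for i
  proof -
    have "q i powr t \<le> ((\<epsilon> / 2 * (1 / 2) ^ Suc i) powr (1 / t)) powr t"
      using q[of i] \<open>0 < t\<close> by (intro powr_mono2) (auto simp: q_def)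
    also have "\<dots> = \<epsilon> / 2 * (1 / 2) ^ Suc i"
      using \<open>0 < t\<close> \<open>0 < \<epsilon>\<close> by (simp add: powr_powr)
    finally show ?thesis .
  qed
  show thesis
  proof (rule that[of U r])
    fix I :: "nat set" assume "finite I"
    have "ennreal (\<Sum>i\<in>I. diameter (U i) powr t) = (\<Sum>i\<in>I. ennreal (diameter (U i) powr t))"
      by (rule sum_ennreal[symmetric]) simp
    also have "\<dots> \<le> (\<Sum>i\<in>I. diam_pow s (U i))"
      using U assms by (intro sum_mono diameter_powr_le_diam_pow) (auto simp: \<delta>'_def)
    also have "\<dots> \<le> (\<Sum>i. diam_pow s (U i))"
      by (intro sum_le_suminf \<open>finite I\<close>) auto
    finally have "ennreal (\<Sum>i\<in>I. diameter (U i) powr t) < ennreal (\<epsilon> / 2)"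
      using sum by order
    then have 1: "(\<Sum>i\<in>I. diameter (U i) powr t) \<le> \<epsilon> / 2"
      by (subst (asm) ennreal_less_iff) (auto intro: sum_nonneg)
    have "(\<Sum>i\<in>I. q i powr t) \<le> (\<Sum>i\<in>I. \<epsilon> / 2 * (1 / 2) ^ Suc i)"
      by (intro sum_mono qt)
    also have "\<dots> \<le> (\<Sum>i. \<epsilon> / 2 * (1 / 2) ^ Suc i)"
      using \<open>0 < \<epsilon>\<close> power_half_series
      by (intro sum_le_suminf \<open>finite I\<close>) (auto intro!: summable_mult simp: sums_iff)
    also have "\<dots> = \<epsilon> / 2 * (\<Sum>i. (1 / 2) ^ Suc i)"
      by (rule suminf_mult) (use power_half_series in \<open>auto simp: sums_iff\<close>)
    also have "\<dots> = \<epsilon> / 2" using power_half_series by (simp add: sums_iff)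
    finally have 2: "(\<Sum>i\<in>I. q i powr t) \<le> \<epsilon> / 2" .
    have "r i powr t \<le> diameter (U i) powr t + q i powr t" for i
      by (auto simp: r_def max_def)
    then have "(\<Sum>i\<in>I. r i powr t) \<le> (\<Sum>i\<in>I. diameter (U i) powr t + q i powr t)"
      by (intro sum_mono)
    then show "(\<Sum>i\<in>I. r i powr t) \<le> \<epsilon>"
      using 1 2 by (simp add: sum.distrib)
  next
    fix i show "r i < \<delta>"
      using U(3)[of i] \<open>0 < \<delta>\<close> by (auto simp: r_def q_def \<delta>'_def)
    show "0 < r i" using q[of i] by (auto simp: r_def)
    show "diameter (U i) \<le> r i" by (auto simp: r_def)
  qed (use U in auto)
qed

lemma hausdorff_dim_le:
  "0 \<le> t \<Longrightarrow> hausdorff_measure t S = 0 \<Longrightarrow> hausdorff_dim S \<le> t"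
  unfolding hausdorff_dim_def by (rule cInf_lower) (auto intro!: bdd_belowI[of _ 0])

text \<open>The exponent \<open>u\<close>, here and below, makes the set of null exponents
  non-empty; otherwise its \<open>Inf\<close> would be unspecified.\<close>

lemma hausdorff_dim_nonneg:
  assumes "0 \<le> u" "hausdorff_measure u S = 0"
  shows "0 \<le> hausdorff_dim S"
  unfolding hausdorff_dim_def using assms by (intro cInf_greatest) auto

lemma hausdorff_dim_lessD:
  assumes "hausdorff_dim S < t" "0 \<le> u" "hausdorff_measure u S = 0"
  obtains s where "0 \<le> s" "s < t" "hausdorff_measure s S = 0"
  using assms cInf_lessD[of "{s. 0 \<le> s \<and> hausdorff_measure s S = 0}" t]
  unfolding hausdorff_dim_def by auto

lemma hausdorff_measure_mono:
  assumes "S \<subseteq> T"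
  shows "hausdorff_measure s S \<le> hausdorff_measure s T"
  unfolding hausdorff_measure_def hausdorff_premeasure_def
  using assms by (intro SUP_mono' INF_superset_mono) auto

lemma hausdorff_dim_mono:
  assumes "S \<subseteq> T" "0 \<le> u" "hausdorff_measure u T = 0"
  shows "hausdorff_dim S \<le> hausdorff_dim T"
  unfolding hausdorff_dim_def
proof (rule cInf_superset_mono)
  show "{s. 0 \<le> s \<and> hausdorff_measure s T = 0} \<subseteq> {s. 0 \<le> s \<and> hausdorff_measure s S = 0}"
    using hausdorff_measure_mono[OF assms(1)] by (metis (mono_tags, lifting) Collect_mono le_zero_eq)
qed (use assms in \<open>auto intro!: bdd_belowI[of _ 0]\<close>)

section \<open>Similarities and connected sets\<close>

lemma onorm_similarity:
  fixes T :: "'a::euclidean_space \<Rightarrow> 'a"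
  assumes "orthogonal_transformation T" "0 < c"
  shows "onorm (\<lambda>v. c *\<^sub>R T v) = c"
proof -
  have norm: "norm (c *\<^sub>R T v) = c * norm v" for v
    using assms by (simp add: orthogonal_transformation_norm)
  obtain b :: 'a where "b \<in> Basis" using nonempty_Basis by blast
  have "linear (\<lambda>v. c *\<^sub>R T v)"
    using assms by (intro linear_compose_scale_right orthogonal_transformation_linear)
  then have "bounded_linear (\<lambda>v. c *\<^sub>R T v)"
    by (simp add: linear_conv_bounded_linear)
  from onorm[OF this, of b] \<open>b \<in> Basis\<close> norm[of b] have "c \<le> onorm (\<lambda>v. c *\<^sub>R T v)" by simp
  moreover have "onorm (\<lambda>v. c *\<^sub>R T v) \<le> c"
    by (rule onorm_le) (simp only: norm order_refl)
  ultimately show ?thesis by simp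
qed

lemma inv_similarity:
  fixes T :: "'a::euclidean_space \<Rightarrow> 'a"
  assumes "orthogonal_transformation T" "0 < c"
  shows "inv (\<lambda>v. c *\<^sub>R T v) = (\<lambda>v. inverse c *\<^sub>R inv T v)"
proof (rule inv_equality)
  have T: "bij T" by (rule orthogonal_transformation_bij[OF assms(1)])
  have T': "orthogonal_transformation (inv T)" by (rule orthogonal_transformation_inv[OF assms(1)])
  fix v
  show "inverse c *\<^sub>R inv T (c *\<^sub>R T v) = v"
    using assms T T' by (simp add: orthogonal_transformation_scaleR bij_is_inj)
  show "c *\<^sub>R T (inverse c *\<^sub>R inv T v) = v"
    using assms T by (simp add: orthogonal_transformation_scaleR bij_is_surj surj_f_inv_f)
qed

text \<open>
  The distance to \<open>a\<close> takes \<open>card k + 1\<close> equally spaced values on \<open>S\<close>, and two of the points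
  realising them lie in the same piece.
\<close>

lemma connected_cover_dist_le:
  fixes S :: "'a::metric_space set"
  assumes "connected S" "finite k" "S \<subseteq> (\<Union>z\<in>k. E z)"
    and E: "\<And>z x y. z \<in> k \<Longrightarrow> x \<in> E z \<Longrightarrow> y \<in> E z \<Longrightarrow> dist x y \<le> B"
    and "a \<in> S" "b \<in> S"
  shows "dist a b \<le> real (card k) * B"
proof (rule ccontr)
  define d m where "d = dist a b" and "m = card k"
  assume "\<not> ?thesis"
  then have "m * B < d" by (simp add: d_def m_def)
  have "k \<noteq> {}" using assms by auto
  then have "0 < m" using \<open>finite k\<close> by (simp add: m_def card_gt_0_iff)
  have conn: "connected (dist a ` S)"
    by (intro connected_continuous_image continuous_intros \<open>connected S\<close>)
  have "dist a a \<in> dist a ` S" "dist a b \<in> dist a ` S" using assms by blast+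
  then have sub: "{0..d} \<subseteq> dist a ` S"
    using connected_contains_Icc[OF conn, of 0 d] by (auto simp: d_def)
  have "\<exists>p z. p \<in> S \<and> dist a p = d * (real i / real m) \<and> z \<in> k \<and> p \<in> E z" if "i \<in> {0..m}" for i
  proof -
    have "d * (real i / real m) \<le> d * 1"
      using that \<open>0 < m\<close> by (intro mult_left_mono) (auto simp: d_def divide_simps)
    moreover have "0 \<le> d * (real i / real m)" by (simp add: d_def)
    ultimately have "d * (real i / real m) \<in> {0..d}" by simp
    with sub obtain p where "p \<in> S" "dist a p = d * (real i / real m)" by (metis imageE subsetD)
    with assms(3) show ?thesis by blast
  qed
  then obtain p z where pz: "\<And>i. i \<in> {0..m} \<Longrightarrow> p i \<in> S \<and> dist a (p i) = d * (real i / real m) \<and> z i \<in> k \<and> p i \<in> E (z i)"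
    by metis
  have "\<not> inj_on z {0..m}"
  proof
    assume "inj_on z {0..m}"
    then have "card {0..m} \<le> card k" using pz \<open>finite k\<close> by (intro card_inj_on_le) auto
    then show False by (simp add: m_def)
  qed
  then obtain i j where ij: "i \<in> {0..m}" "j \<in> {0..m}" "z i = z j" "i < j"
    unfolding inj_on_def by (metis linorder_neqE_nat)
  have "d / m \<le> d * (real j / m) - d * (real i / m)"
  proof -
    have "d * 1 \<le> d * (real j - real i)" using ij by (intro mult_left_mono) (auto simp: d_def)
    then show ?thesis using \<open>0 < m\<close> by (simp add: divide_simps algebra_simps)
  qed
  also have "\<dots> = dist a (p j) - dist a (p i)" using pz ij by simp
  also have "\<dots> \<le> dist (p i) (p j)" using dist_triangle[of a "p j" "p i"] by simp
  also have "\<dots> \<le> B" using E[of "z i" "p i" "p j"] pz ij by metis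
  finally show False using \<open>m * B < d\<close> \<open>0 < m\<close> by (simp add: divide_simps mult.commute)
qed

text \<open>
  The inverse of \<open>f\<close> is \<open>1 / m\<close>-Lipschitz on the largest ball around \<open>f y\<close> contained in the
  open image, so a boundary point of this ball that is missed by \<open>f\<close> has distance at least \<open>m * \<rho>\<close>.
\<close>

lemma ball_subset_image_ball:
  fixes f :: "'a::euclidean_space \<Rightarrow> 'a"
  assumes inj: "inj_on f (ball y \<rho>)" and "0 < \<rho>" "0 < m"
    and der: "\<And>x. x \<in> ball y \<rho> \<Longrightarrow> \<exists>c T. m \<le> c \<and> orthogonal_transformation T \<and> (f has_derivative (\<lambda>v. c *\<^sub>R T v)) (at x)"
  shows "ball (f y) (m * \<rho>) \<subseteq> f ` ball y \<rho>"
proof (cases "f ` ball y \<rho> = UNIV")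
  case False
  define V where "V = f ` ball y \<rho>"
  define g where "g = the_inv_into (ball y \<rho>) f"
  have gf: "g (f x) = x" if "x \<in> ball y \<rho>" for x
    using inj that by (simp add: g_def the_inv_into_f_f)
  have cont: "continuous_on (ball y \<rho>) f"
    using der by (meson continuous_at_imp_continuous_on has_derivative_continuous)
  have "open V" unfolding V_def by (rule invariance_of_domain[OF cont open_ball inj])
  moreover have "- V \<noteq> {}" using False by (auto simp: V_def)
  ultimately obtain q where q: "q \<in> - V" "infdist (f y) (- V) = dist (f y) q"
    using infdist_attains_inf[of "- V" "f y"] by (auto simp: closed_Compl)
  define R where "R = dist (f y) q"
  have "f y \<in> V" using \<open>0 < \<rho>\<close> by (auto simp: V_def)
  then have "0 < R" using q by (auto simp: R_def)
  have sub: "ball (f y) R \<subseteq> V"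
  proof
    fix p assume "p \<in> ball (f y) R"
    then show "p \<in> V" using infdist_le[of p "- V" "f y"] q by (force simp: R_def)
  qed
  have "m * \<rho> \<le> R"
  proof (rule ccontr)
    assume "\<not> ?thesis"
    then have less: "R / m < \<rho>" using \<open>0 < m\<close> by (simp add: divide_simps mult.commute)
    have gder: "\<exists>h. (g has_derivative h) (at p) \<and> onorm h \<le> 1 / m" if p: "p \<in> V" for p
    proof -
      obtain x where x: "x \<in> ball y \<rho>" "p = f x" using p by (auto simp: V_def)
      then obtain c T where cT: "m \<le> c" "orthogonal_transformation T"
        "(f has_derivative (\<lambda>v. c *\<^sub>R T v)) (at x)" using der by blast
      have "0 < c" using cT \<open>0 < m\<close> by simp
      have T': "orthogonal_transformation (inv T)" by (rule orthogonal_transformation_inv[OF cT(2)])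
      have "(g has_derivative (\<lambda>v. inverse c *\<^sub>R inv T v)) (at (f x))"
      proof (rule has_derivative_inverse_strong[OF open_ball x(1) cont gf cT(3)])
        show "(\<lambda>v. c *\<^sub>R T v) \<circ> (\<lambda>v. inverse c *\<^sub>R inv T v) = id"
          using \<open>0 < c\<close> orthogonal_transformation_surj[OF cT(2)]
          by (auto simp: fun_eq_iff orthogonal_transformation_scaleR[OF cT(2)] surj_f_inv_f)
      qed
      moreover have "onorm (\<lambda>v. inverse c *\<^sub>R inv T v) = inverse c"
        using T' \<open>0 < c\<close> by (intro onorm_similarity) auto
      moreover have "inverse c \<le> 1 / m" using cT \<open>0 < m\<close> by (simp add: divide_simps)
      ultimately show ?thesis using x by auto
    qed
    then obtain h where h: "\<And>p. p \<in> V \<Longrightarrow> (g has_derivative h p) (at p) \<and> onorm (h p) \<le> 1 / m"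
      by metis
    have hw: "(g has_derivative h p) (at p within ball (f y) R)" "onorm (h p) \<le> 1 / m"
      if "p \<in> ball (f y) R" for p
      using h[of p] sub that by (blast intro: has_derivative_at_withinI)+
    \<comment> \<open>Since \<open>R / m < \<rho>\<close>, the inverse maps this ball into a compact
      part of \<open>ball y \<rho>\<close>. The image of that part is closed, so it also captures
      the boundary point \<open>q\<close>, which was chosen outside \<open>V\<close>.\<close>
    have "ball (f y) R \<subseteq> f ` cball y (R / m)"
    proof
      fix p assume p: "p \<in> ball (f y) R"
      have "norm (g p - g (f y)) \<le> 1 / m * norm (p - f y)"
        by (rule differentiable_bound[OF convex_ball hw p]) (simp_all add: \<open>0 < R\<close>)
      also have "\<dots> \<le> 1 / m * R"
        using p \<open>0 < m\<close> by (intro mult_left_mono) (auto simp: dist_norm norm_minus_commute)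
      finally have "dist (g p) y \<le> R / m" using gf[of y] \<open>0 < \<rho>\<close> by (simp add: dist_norm)
      moreover have "f (g p) = p" using p sub gf by (force simp: V_def)
      ultimately show "p \<in> f ` cball y (R / m)"
        by (metis dist_commute imageI mem_cball)
    qed
    moreover have cb: "cball y (R / m) \<subseteq> ball y \<rho>" using less by auto
    then have "closed (f ` cball y (R / m))"
      by (intro compact_imp_closed compact_continuous_image continuous_on_subset[OF cont]) auto
    ultimately have "closure (ball (f y) R) \<subseteq> f ` cball y (R / m)"
      by (rule closure_minimal)
    then have "q \<in> f ` cball y (R / m)" using \<open>0 < R\<close> by (auto simp: R_def)
    then show False using q cb by (auto simp: V_def)
  qed
  then show ?thesis using sub by (force simp: V_def)
qed auto

section \<open>Finite compositions, and segments and balls inside cones\<close>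

primrec comp_word :: "('i \<Rightarrow> 'a \<Rightarrow> 'a) \<Rightarrow> 'i list \<Rightarrow> 'a \<Rightarrow> 'a" where
  "comp_word \<phi> [] = id"
| "comp_word \<phi> (e # w) = \<phi> e \<circ> comp_word \<phi> w"

lemma comp_word_append: "comp_word \<phi> (u @ v) = comp_word \<phi> u \<circ> comp_word \<phi> v"
  by (induction u) (auto simp: o_assoc)

lemma word_map_eq_comp_word: "word_map \<phi> \<omega> n = comp_word \<phi> (map \<omega> [0..<n])"
  by (induction n) (auto simp: comp_word_append)

lemma segment_subset_open_cone:
  fixes u :: "'a::euclidean_space"
  assumes "norm u = 1" "0 < \<gamma>" "\<gamma> < pi" "0 < l" "0 < t" "t < l"
  shows "x + t *\<^sub>R u \<in> open_cone x u \<gamma> l"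
proof -
  have "cos (\<gamma> / 2) < 1" using assms cos_monotone_0_pi[of 0 "\<gamma> / 2"] by simp
  moreover have "u \<bullet> u = 1" using assms by (simp add: norm_eq_1)
  ultimately show ?thesis using assms by (auto simp: open_cone_def)
qed

lemma ball_subset_open_cone:
  assumes "0 < \<gamma>" "\<gamma> < pi" "0 < l"
  obtains \<rho> where "0 < \<rho>"
    "\<And>x u :: 'a::euclidean_space. norm u = 1 \<Longrightarrow> ball (x + (l / 2) *\<^sub>R u) \<rho> \<subseteq> open_cone x u \<gamma> l"
proof
  define k where "k = cos (\<gamma> / 2)"
  have "k < 1" using assms cos_monotone_0_pi[of 0 "\<gamma> / 2"] by (simp add: k_def)
  have "0 < k" using assms by (auto simp: k_def intro!: cos_gt_zero_pi)
  \<comment> \<open>A point within \<rho> of the axis point at height l/2 has height above l/2 -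
    \<rho> and distance below l/2 + \<rho> from the vertex, so
    \<open>k * (l / 2 + \<rho>) < l / 2 - \<rho>\<close> suffices; this value satisfies it because
    \<open>k < 1\<close>.\<close>
  define \<rho> where "\<rho> = (1 - k) * l / 4"
  have \<rho>: "\<rho> < l / 2" "k * (l / 2 + \<rho>) < l / 2 - \<rho>"
  proof -
    have "\<rho> \<le> 1 * l / 4" unfolding \<rho>_def using \<open>0 < k\<close> \<open>0 < l\<close>
      by (intro divide_right_mono mult_right_mono) auto
    then show "\<rho> < l / 2" using \<open>0 < l\<close> by simp
    have "k * \<rho> < \<rho>" using \<open>k < 1\<close> \<open>0 < l\<close> by (simp add: \<rho>_def)
    moreover have "2 * \<rho> = l / 2 - k * l / 2" by (simp add: \<rho>_def field_simps)
    moreover have "k * (l / 2 + \<rho>) = k * l / 2 + k * \<rho>" by (simp add: algebra_simps)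
    ultimately show "k * (l / 2 + \<rho>) < l / 2 - \<rho>" by linarith
  qed
  show "0 < \<rho>" using \<open>k < 1\<close> \<open>0 < l\<close> by (simp add: \<rho>_def)
  fix x u :: 'a assume u: "norm u = 1"
  show "ball (x + (l / 2) *\<^sub>R u) \<rho> \<subseteq> open_cone x u \<gamma> l"
  proof
    fix y assume y: "y \<in> ball (x + (l / 2) *\<^sub>R u) \<rho>"
    define b where "b = y - (x + (l / 2) *\<^sub>R u)"
    have b: "norm b < \<rho>" using y by (simp add: b_def dist_norm norm_minus_commute)
    have yx: "y - x = (l / 2) *\<^sub>R u + b" by (simp add: b_def)
    have "u \<bullet> u = 1" using u by (simp add: norm_eq_1)
    then have eq: "(y - x) \<bullet> u = l / 2 + b \<bullet> u" by (simp add: yx inner_left_distrib)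
    have "\<bar>b \<bullet> u\<bar> \<le> norm b" using Cauchy_Schwarz_ineq2[of b u] u by simp
    moreover have "norm (y - x) \<le> l / 2 + norm b"
      using norm_triangle_ineq[of "(l / 2) *\<^sub>R u" b] u \<open>0 < l\<close> by (simp add: yx)
    then have "k * norm (y - x) \<le> k * (l / 2 + \<rho>)" using b \<open>0 < k\<close> by (intro mult_left_mono) auto
    ultimately show "y \<in> open_cone x u \<gamma> l"
      using b \<rho> by (auto simp: open_cone_def eq k_def[symmetric])
  qed
qed

section \<open>Bounded distortion\<close>

text \<open>Fixes witnesses for the existential assumptions of \<open>CIFS\<close> and a finite
  alphabet, so that derivatives and constants can be named.\<close>

locale CIFS_derivative = CIFS A Y \<phi> for A :: "'i set" and Y :: "'a::euclidean_space set" and \<phi> +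
  fixes W :: "'i \<Rightarrow> 'a set" and \<Phi> :: "'i \<Rightarrow> 'a \<Rightarrow> 'a" and L \<alpha> s :: real
  assumes finite_A: "finite A"
    and Y_subset: "e \<in> A \<Longrightarrow> Y \<subseteq> W e"
    and ext: "e \<in> A \<Longrightarrow> x \<in> Y \<Longrightarrow> \<Phi> e x = \<phi> e x"
    and C1: "e \<in> A \<Longrightarrow> C1_on (W e) (\<Phi> e)"
    and conformal: "e \<in> A \<Longrightarrow> conformal_on (W e) (\<Phi> e)"
    and L: "1 \<le> L" and \<alpha>: "0 < \<alpha>" and s: "0 < s" "s < 1"
    and hoelder: "e \<in> A \<Longrightarrow> x \<in> Y \<Longrightarrow> y \<in> Y \<Longrightarrow>
      \<bar>onorm (frechet_derivative (\<Phi> e) (at x)) - onorm (frechet_derivative (\<Phi> e) (at y))\<bar>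
        \<le> L * inverse (SUP z\<in>Y. onorm (inv (frechet_derivative (\<Phi> e) (at z)))) * dist x y powr \<alpha>"
    and lip: "e \<in> A \<Longrightarrow> lipschitz_on s Y (\<phi> e)"
begin

definition scale :: "'i \<Rightarrow> 'a \<Rightarrow> real" where
  "scale e x = onorm (frechet_derivative (\<Phi> e) (at x))"

lemma similarity_derivative:
  assumes "e \<in> A" "x \<in> Y"
  obtains T where "orthogonal_transformation T" "(\<Phi> e has_derivative (\<lambda>v. scale e x *\<^sub>R T v)) (at x)"
    "0 < scale e x" "onorm (inv (frechet_derivative (\<Phi> e) (at x))) = inverse (scale e x)"
proof -
  have "x \<in> W e" using Y_subset assms by auto
  then obtain c T where cT: "0 < c" "orthogonal_transformation T"
    "(\<Phi> e has_derivative (\<lambda>v. c *\<^sub>R T v)) (at x)"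
    using conformal[OF assms(1)] unfolding conformal_on_def by blast
  have fr: "frechet_derivative (\<Phi> e) (at x) = (\<lambda>v. c *\<^sub>R T v)"
    using frechet_derivative_at[OF cT(3)] by simp
  have sc: "scale e x = c" unfolding scale_def fr using cT by (intro onorm_similarity) auto
  have "onorm (inv (\<lambda>v. c *\<^sub>R T v)) = inverse c"
    unfolding inv_similarity[OF cT(2,1)] using cT
    by (intro onorm_similarity orthogonal_transformation_inv) auto
  then show thesis using that[of T] cT sc fr by auto
qed

lemma scale_pos: "e \<in> A \<Longrightarrow> x \<in> Y \<Longrightarrow> 0 < scale e x"
  by (metis similarity_derivative)

lemma continuous_on_scale:
  assumes "e \<in> A"
  shows "continuous_on Y (scale e)"
proof -
  obtain D :: "'a \<Rightarrow> 'a \<Rightarrow>\<^sub>L 'a" where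
    D: "\<And>x. x \<in> W e \<Longrightarrow> (\<Phi> e has_derivative blinfun_apply (D x)) (at x)" "continuous_on (W e) D"
    using C1[OF assms] unfolding C1_on_def by blast
  have "continuous_on Y (\<lambda>x. norm (D x))"
    by (intro continuous_intros continuous_on_subset[OF D(2)] Y_subset assms)
  moreover have "norm (D x) = scale e x" if "x \<in> Y" for x
  proof -
    have "x \<in> W e" using Y_subset[OF assms] that by auto
    from frechet_derivative_at[OF D(1)[OF this]] show ?thesis
      by (simp add: scale_def norm_blinfun.rep_eq)
  qed
  ultimately show ?thesis by (simp add: continuous_on_eq)
qed

text \<open>The inverse of the supremum in the Hoelder condition is at most
  \<open>scale e y\<close>; this makes the additive estimate multiplicative.\<close>

lemma scale_le:
  assumes "e \<in> A" "x \<in> Y" "y \<in> Y"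
  shows "scale e x \<le> scale e y * (1 + L * dist x y powr \<alpha>)"
proof -
  define M where "M = (SUP z\<in>Y. onorm (inv (frechet_derivative (\<Phi> e) (at z))))"
  have inv: "onorm (inv (frechet_derivative (\<Phi> e) (at z))) = inverse (scale e z)" if "z \<in> Y" for z
    by (metis similarity_derivative assms(1) that)
  \<comment> \<open>Continuity on the compact \<open>Y\<close> bounds the set, so that the
    real-valued supremum really dominates each member.\<close>
  have "continuous_on Y (\<lambda>z. inverse (scale e z))"
    using scale_pos[OF assms(1)] by (intro continuous_intros continuous_on_scale assms) force
  then have "compact ((\<lambda>z. inverse (scale e z)) ` Y)"
    by (intro compact_continuous_image compact)
  then have "bdd_above ((\<lambda>z. inverse (scale e z)) ` Y)"
    by (intro bounded_imp_bdd_above compact_imp_bounded)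
  then have "inverse (scale e y) \<le> (SUP z\<in>Y. inverse (scale e z))"
    using assms by (intro cSUP_upper)
  also have "\<dots> = M" unfolding M_def using inv by (intro SUP_cong) auto
  finally have "inverse (scale e y) \<le> M" .
  then have "inverse M \<le> scale e y"
    using scale_pos[OF assms(1,3)] by (metis inverse_inverse_eq inverse_positive_iff_positive le_imp_inverse_le)
  then have "L * inverse M * dist x y powr \<alpha> \<le> L * scale e y * dist x y powr \<alpha>"
    using L by (intro mult_right_mono mult_left_mono) auto
  moreover have "\<bar>scale e x - scale e y\<bar> \<le> L * inverse M * dist x y powr \<alpha>"
    unfolding scale_def M_def by (rule hoelder[OF assms])
  ultimately show ?thesis by (simp add: algebra_simps)
qed

section \<open>Images of the set and of its interior under compositions\<close>

lemma comp_word_in: "w \<in> lists A \<Longrightarrow> x \<in> Y \<Longrightarrow> comp_word \<phi> w x \<in> Y"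
  using maps_to by (induction w) auto

lemma comp_word_dist:
  assumes "w \<in> lists A" "x \<in> Y" "y \<in> Y"
  shows "dist (comp_word \<phi> w x) (comp_word \<phi> w y) \<le> s ^ length w * dist x y"
  using assms(1)
proof (induction w)
  case (Cons e w)
  then have "dist (comp_word \<phi> (e # w) x) (comp_word \<phi> (e # w) y) \<le> s * dist (comp_word \<phi> w x) (comp_word \<phi> w y)"
    using comp_word_in assms by (auto intro: lipschitz_onD[OF lip])
  also have "\<dots> \<le> s * (s ^ length w * dist x y)"
    using Cons s by (intro mult_left_mono) auto
  finally show ?case by simp
qed auto

lemma inj_on_comp_word: "w \<in> lists A \<Longrightarrow> inj_on (comp_word \<phi> w) Y"
proof (induction w)
  case (Cons e w)
  then have w: "e \<in> A" "w \<in> lists A" by auto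
  have "comp_word \<phi> w ` Y \<subseteq> Y" using comp_word_in[OF w(2)] by blast
  then have "inj_on (\<phi> e) (comp_word \<phi> w ` Y)"
    using one_to_one w(1) inj_on_subset by blast
  then show ?case using comp_inj_on[OF Cons.IH[OF w(2)]] by (simp only: comp_word.simps)
qed auto

lemma comp_word_ext: "w \<in> lists A \<Longrightarrow> x \<in> Y \<Longrightarrow> comp_word \<Phi> w x = comp_word \<phi> w x"
  by (induction w) (auto simp: ext comp_word_in)

lemma continuous_on_comp_word: "w \<in> lists A \<Longrightarrow> continuous_on Y (comp_word \<phi> w)"
proof -
  assume w: "w \<in> lists A"
  have "lipschitz_on (s ^ length w) Y (comp_word \<phi> w)"
    using comp_word_dist[OF w] s by (auto intro!: lipschitz_onI)
  then show ?thesis by (rule lipschitz_on_continuous_on)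
qed

text \<open>By invariance of domain the injective continuous image of the open interior is open,
  hence lies in the interior of \<open>Y\<close>.\<close>

lemma comp_word_interior:
  assumes "w \<in> lists A"
  shows "comp_word \<phi> w ` interior Y \<subseteq> interior Y"
proof (rule interior_maximal)
  show "comp_word \<phi> w ` interior Y \<subseteq> Y" using comp_word_in[OF assms] interior_subset by blast
  show "open (comp_word \<phi> w ` interior Y)"
    using interior_subset
    by (intro invariance_of_domain continuous_on_subset[OF continuous_on_comp_word[OF assms]]
        inj_on_subset[OF inj_on_comp_word[OF assms]]) auto
qed

text \<open>The Open Set Condition separates the words at the first letter where they differ;
  injectivity along the common prefix \<open>p\<close> preserves disjointness.\<close>

lemma comp_word_interior_disjoint:
  assumes "p \<in> lists A" "u \<in> lists A" "v \<in> lists A" "a \<in> A" "b \<in> A" "a \<noteq> b"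
  shows "comp_word \<phi> (p @ a # u) ` interior Y \<inter> comp_word \<phi> (p @ b # v) ` interior Y = {}"
proof -
  define E where "E c x = \<phi> c ` comp_word \<phi> x ` interior Y" for c x
  have sub: "E c x \<subseteq> \<phi> c ` interior Y" if "x \<in> lists A" for c x
    unfolding E_def by (intro image_mono comp_word_interior that)
  have subY: "E c x \<subseteq> Y" if "c \<in> A" "x \<in> lists A" for c x
    using sub[OF that(2), of c] interior_subset[of Y] maps_to that(1) by blast
  have "\<phi> a ` interior Y \<inter> \<phi> b ` interior Y = {}" using open_set_condition assms by blast
  then have "E a u \<inter> E b v = {}" using sub[OF assms(2), of a] sub[OF assms(3), of b] by blast
  then have "comp_word \<phi> p ` E a u \<inter> comp_word \<phi> p ` E b v = {}"
    using inj_on_image_Int[OF inj_on_comp_word[OF assms(1)] subY[OF assms(4,2)] subY[OF assms(5,3)]]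
    by simp
  then show ?thesis by (simp add: E_def comp_word_append image_comp o_assoc)
qed

text \<open>The norm of the derivative of the composition at \<open>x\<close>, by the chain rule for
  similarities: each letter is evaluated at the image of \<open>x\<close> under the letters to its
  right.\<close>

primrec word_scale :: "'i list \<Rightarrow> 'a \<Rightarrow> real" where
  "word_scale [] x = 1"
| "word_scale (e # w) x = scale e (comp_word \<phi> w x) * word_scale w x"

lemma word_scale_pos: "w \<in> lists A \<Longrightarrow> x \<in> Y \<Longrightarrow> 0 < word_scale w x"
  by (induction w) (auto intro!: mult_pos_pos scale_pos comp_word_in)

lemma word_scale_append: "word_scale (u @ v) x = word_scale u (comp_word \<phi> v x) * word_scale v x"
  by (induction u) (auto simp: comp_word_append)

lemma comp_word_derivative:
  assumes "w \<in> lists A" "x \<in> Y"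
  shows "\<exists>T. orthogonal_transformation T \<and> (comp_word \<Phi> w has_derivative (\<lambda>v. word_scale w x *\<^sub>R T v)) (at x)"
  using assms(1)
proof (induction w)
  case Nil
  have "(id has_derivative (\<lambda>v. v)) (at x)" by (simp add: id_def)
  then show ?case by (auto intro!: exI[of _ "\<lambda>v. v"])
next
  case (Cons e w)
  then obtain T where T: "orthogonal_transformation T"
    "(comp_word \<Phi> w has_derivative (\<lambda>v. word_scale w x *\<^sub>R T v)) (at x)" by auto
  have eq: "comp_word \<Phi> w x = comp_word \<phi> w x" "comp_word \<phi> w x \<in> Y" "e \<in> A"
    using Cons assms by (auto simp: comp_word_ext comp_word_in)
  obtain T' where T': "orthogonal_transformation T'"
    "(\<Phi> e has_derivative (\<lambda>v. scale e (comp_word \<phi> w x) *\<^sub>R T' v)) (at (comp_word \<Phi> w x))"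
    using eq by (metis similarity_derivative)
  show ?case
    using diff_chain_at[OF T(2) T'(2)] orthogonal_transformation_compose[OF T'(1) T(1)]
    by (auto simp: o_def orthogonal_transformation_scaleR[OF T'(1)] intro!: exI[of _ "T' \<circ> T"])
qed

text \<open>The exponent is L times the sum over all k of
  \<open>(s ^ k * diameter Y) powr \<alpha>\<close>, a geometric series.\<close>

definition distortion :: real where
  "distortion = exp (L * (diameter Y powr \<alpha> / (1 - s powr \<alpha>)))"

lemma diameter_nonneg: "0 \<le> diameter Y"
  by (intro diameter_ge_0 compact_imp_bounded compact)

lemma s_powr: "s powr \<alpha> < 1"
  using powr_less_mono2[of \<alpha> s 1] s \<alpha> by simp

lemma distortion_ge_1: "1 \<le> distortion"
  using L s_powr unfolding distortion_def by simp

text \<open>After a suffix of length k the images of \<open>x\<close> and \<open>y\<close> are at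
  most \<open>s ^ k * D\<close> apart, so the next factor changes by at most
  \<open>exp (L * (s ^ k * D) powr \<alpha>)\<close>. The exponents have a sum bounded independently
  of the word.\<close>

lemma word_scale_le:
  assumes "w \<in> lists A" "x \<in> Y" "y \<in> Y"
  shows "word_scale w x \<le> distortion * word_scale w y"
proof -
  define D where "D = diameter Y"
  have "word_scale w x \<le> exp (\<Sum>k<length w. L * (s ^ k * D) powr \<alpha>) * word_scale w y"
    using assms(1)
  proof (induction w)
    case (Cons e w)
    then have w: "w \<in> lists A" "e \<in> A" by auto
    let ?x = "comp_word \<phi> w x" and ?y = "comp_word \<phi> w y"
    have "dist ?x ?y \<le> s ^ length w * dist x y" by (rule comp_word_dist[OF w(1) assms(2,3)])
    also have "\<dots> \<le> s ^ length w * D"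
      using assms s by (intro mult_left_mono) (auto simp: D_def intro: diameter_bounded_bound compact_imp_bounded compact)
    finally have "L * dist ?x ?y powr \<alpha> \<le> L * (s ^ length w * D) powr \<alpha>"
      using L \<alpha> by (intro mult_left_mono powr_mono2) auto
    then have le: "1 + L * dist ?x ?y powr \<alpha> \<le> exp (L * (s ^ length w * D) powr \<alpha>)"
      by (intro order_trans[OF _ exp_ge_add_one_self]) simp
    have in_Y: "?x \<in> Y" "?y \<in> Y" using w assms by (auto intro: comp_word_in)
    have "scale e ?x \<le> scale e ?y * (1 + L * dist ?x ?y powr \<alpha>)"
      by (rule scale_le[OF w(2) in_Y])
    also have "\<dots> \<le> scale e ?y * exp (L * (s ^ length w * D) powr \<alpha>)"
      using le scale_pos[OF w(2) in_Y(2)] by (intro mult_left_mono) auto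
    finally have "word_scale (e # w) x \<le> (scale e ?y * exp (L * (s ^ length w * D) powr \<alpha>)) *
        (exp (\<Sum>k<length w. L * (s ^ k * D) powr \<alpha>) * word_scale w y)"
      using Cons.IH scale_pos[OF w(2) in_Y(2)] word_scale_pos[OF w(1) assms(2)]
      by (auto intro!: mult_mono mult_nonneg_nonneg)
    then show ?case by (simp add: exp_add algebra_simps)
  qed auto
  also have "\<dots> \<le> distortion * word_scale w y"
  proof (intro mult_right_mono)
    have "(\<Sum>k<length w. L * (s ^ k * D) powr \<alpha>) = L * (D powr \<alpha> * (\<Sum>k<length w. (s powr \<alpha>) ^ k))"
      using s by (simp add: D_def diameter_nonneg powr_mult powr_power sum_distrib_left powr_powr
          algebra_simps powr_realpow[symmetric])
    also have "\<dots> \<le> L * (D powr \<alpha> * (1 / (1 - s powr \<alpha>)))"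
    proof (intro mult_left_mono)
      have "(\<Sum>k<length w. (s powr \<alpha>) ^ k) = (1 - (s powr \<alpha>) ^ length w) / (1 - s powr \<alpha>)"
        using s_powr by (simp add: sum_gp_strict)
      also have "\<dots> \<le> 1 / (1 - s powr \<alpha>)" using s_powr by (intro divide_right_mono) auto
      finally show "(\<Sum>k<length w. (s powr \<alpha>) ^ k) \<le> 1 / (1 - s powr \<alpha>)" .
    qed (use L in auto)
    finally show "exp (\<Sum>k<length w. L * (s ^ k * D) powr \<alpha>) \<le> distortion"
      by (simp add: distortion_def D_def)
  qed (use word_scale_pos assms in force)
  finally show ?thesis .
qed

text \<open>The factor \<open>distortion\<close> makes the weight submultiplicative.\<close>

definition weight :: "'i list \<Rightarrow> real" where
  "weight w = distortion * word_scale w (SOME y. y \<in> Y)"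

lemma base_in: "(SOME y. y \<in> Y) \<in> Y"
  using nonempty by (simp add: some_in_eq)

lemma weight_pos: "w \<in> lists A \<Longrightarrow> 0 < weight w"
  using distortion_ge_1 word_scale_pos[OF _ base_in] by (auto simp: weight_def)

lemma word_scale_le_weight: "w \<in> lists A \<Longrightarrow> x \<in> Y \<Longrightarrow> word_scale w x \<le> weight w"
  unfolding weight_def by (intro word_scale_le base_in)

lemma weight_le_word_scale: "w \<in> lists A \<Longrightarrow> x \<in> Y \<Longrightarrow> weight w \<le> distortion\<^sup>2 * word_scale w x"
  unfolding weight_def power2_eq_square using word_scale_le[OF _ base_in] distortion_ge_1
  by (auto simp: mult.assoc)

lemma weight_append_le:
  assumes "u \<in> lists A" "v \<in> lists A"
  shows "weight (u @ v) \<le> weight u * weight v"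
proof -
  let ?y = "SOME y. y \<in> Y"
  have "weight (u @ v) = word_scale u (comp_word \<phi> v ?y) * (distortion * word_scale v ?y)"
    by (simp add: weight_def word_scale_append)
  also have "\<dots> \<le> weight u * (distortion * word_scale v ?y)"
    using assms distortion_ge_1 word_scale_pos[OF assms(2) base_in]
    by (intro mult_right_mono word_scale_le_weight comp_word_in base_in mult_nonneg_nonneg) auto
  finally show ?thesis by (simp add: weight_def)
qed

lemma weight_append_ge:
  assumes "u \<in> lists A" "v \<in> lists A"
  shows "weight u * weight v \<le> distortion\<^sup>2 * weight (u @ v)"
proof -
  let ?y = "SOME y. y \<in> Y"
  have "weight u * weight v \<le> (distortion\<^sup>2 * word_scale u (comp_word \<phi> v ?y)) * weight v"
    using assms weight_pos[OF assms(2)]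
    by (intro mult_right_mono weight_le_word_scale comp_word_in base_in) auto
  then show ?thesis by (simp add: weight_def word_scale_append algebra_simps)
qed

text \<open>The mean value inequality, applied only along segments inside \<open>Y\<close> because
  \<open>Y\<close> may fail to be convex.\<close>

lemma dist_segment_le:
  assumes "w \<in> lists A" "closed_segment x y \<subseteq> Y"
  shows "dist (comp_word \<phi> w x) (comp_word \<phi> w y) \<le> weight w * dist x y"
proof -
  obtain T where T: "\<And>z. z \<in> Y \<Longrightarrow> orthogonal_transformation (T z)"
    "\<And>z. z \<in> Y \<Longrightarrow> (comp_word \<Phi> w has_derivative (\<lambda>v. word_scale w z *\<^sub>R T z v)) (at z)"
    using comp_word_derivative[OF assms(1)] by metis
  have "norm (comp_word \<Phi> w x - comp_word \<Phi> w y) \<le> weight w * norm (x - y)"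
  proof (rule differentiable_bound[of "closed_segment x y" _ "\<lambda>z v. word_scale w z *\<^sub>R T z v"])
    fix z assume "z \<in> closed_segment x y"
    then have z: "z \<in> Y" using assms by auto
    show "(comp_word \<Phi> w has_derivative (\<lambda>v. word_scale w z *\<^sub>R T z v)) (at z within closed_segment x y)"
      using T(2)[OF z] by (rule has_derivative_at_withinI)
    show "onorm (\<lambda>v. word_scale w z *\<^sub>R T z v) \<le> weight w"
      using onorm_similarity[OF T(1)[OF z] word_scale_pos[OF assms(1) z]]
        word_scale_le_weight[OF assms(1) z] by simp
  qed auto
  moreover have "x \<in> Y" "y \<in> Y" using assms by auto
  ultimately show ?thesis using assms(1) by (simp add: comp_word_ext dist_norm)
qed

text \<open>
  Every point of \<open>Y\<close> is joined inside its cone to the centre of a ball of fixed radius contained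
  in \<open>Y\<close>; finitely many pieces of \<open>Y\<close> with nearby centres suffice, and connectedness chains them.
\<close>

lemma dist_le_weight:
  obtains C where "0 < C" "\<And>w x y. w \<in> lists A \<Longrightarrow> x \<in> Y \<Longrightarrow> y \<in> Y \<Longrightarrow>
    dist (comp_word \<phi> w x) (comp_word \<phi> w y) \<le> C * weight w"
proof -
  obtain \<gamma> l where \<gamma>l: "0 < \<gamma>" "\<gamma> < pi / 2" "0 < l"
    "\<And>x. x \<in> Y \<Longrightarrow> \<exists>u. norm u = 1 \<and> open_cone x u \<gamma> l \<subseteq> interior Y"
    using cone_property by blast
  have "\<gamma> < pi" using \<gamma>l pi_gt_zero by linarith
  then obtain \<rho> where \<rho>: "0 < \<rho>"
    "\<And>x u :: 'a. norm u = 1 \<Longrightarrow> ball (x + (l / 2) *\<^sub>R u) \<rho> \<subseteq> open_cone x u \<gamma> l"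
    using ball_subset_open_cone[OF \<gamma>l(1) _ \<gamma>l(3)] by blast
  obtain u where u: "\<And>x. x \<in> Y \<Longrightarrow> norm (u x) = 1 \<and> open_cone x (u x) \<gamma> l \<subseteq> interior Y"
    using \<gamma>l(4) by metis
  define p where "p x = x + (l / 2) *\<^sub>R u x" for x
  have ball: "ball (p x) \<rho> \<subseteq> Y" if "x \<in> Y" for x
    using \<rho>(2)[of "u x" x] u[OF that] interior_subset[of Y] by (auto simp: p_def)
  then have pY: "p x \<in> Y" if "x \<in> Y" for x using that \<rho>(1) by force
  have seg: "closed_segment x (p x) \<subseteq> Y" if x: "x \<in> Y" for x
  proof
    fix z assume "z \<in> closed_segment x (p x)"
    then obtain t where t: "0 \<le> t" "t \<le> 1" "z = x + (t * l / 2) *\<^sub>R u x"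
      by (auto simp: in_segment p_def algebra_simps)
    have "t * l / 2 < l" using t \<gamma>l(3) mult_right_mono[of t 1 l] by auto
    then show "z \<in> Y"
      using segment_subset_open_cone[of "u x" \<gamma> l "t * l / 2" x] u[OF x] t \<gamma>l \<open>\<gamma> < pi\<close> x
        interior_subset[of Y] by (cases "t = 0") auto
  qed
  have dp: "dist x (p x) = l / 2" if "x \<in> Y" for x
    using u[OF that] \<gamma>l(3) by (simp add: p_def dist_norm)
  obtain k where k: "k \<subseteq> Y" "finite k" "Y \<subseteq> (\<Union>z\<in>k. ball z (\<rho> / 2))"
  proof -
    have "Y \<subseteq> (\<Union>z\<in>Y. ball z (\<rho> / 2))" using \<rho>(1) by auto
    then show thesis using compactE_image[OF compact, of Y "\<lambda>z. ball z (\<rho> / 2)"] that by (metis open_ball)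
  qed
  \<comment> \<open>Two points of one piece have centres less than \<rho> apart, so the segment
    between these centres stays in a single ball inside \<open>Y\<close>.\<close>
  define E where "E z = {x \<in> Y. p x \<in> ball z (\<rho> / 2)}" for z
  have cover: "Y \<subseteq> (\<Union>z\<in>k. E z)" using k pY by (fastforce simp: E_def)
  have E: "dist (comp_word \<phi> w x) (comp_word \<phi> w y) \<le> weight w * (l + \<rho>)"
    if w: "w \<in> lists A" and xy: "x \<in> E z" "y \<in> E z" for w x y z
  proof -
    have Y: "x \<in> Y" "y \<in> Y" using xy by (auto simp: E_def)
    have d: "dist (p x) (p y) < \<rho>"
      using xy dist_triangle_half_r[of z "p x" \<rho> "p y"] by (auto simp: E_def)
    then have "closed_segment (p x) (p y) \<subseteq> ball (p x) \<rho>"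
      using \<rho>(1) by (intro closed_segment_subset) auto
    then have pp: "closed_segment (p x) (p y) \<subseteq> Y" using ball[OF Y(1)] by auto
    have "dist (comp_word \<phi> w x) (comp_word \<phi> w y) \<le>
        dist (comp_word \<phi> w x) (comp_word \<phi> w (p x)) +
        dist (comp_word \<phi> w (p x)) (comp_word \<phi> w (p y)) +
        dist (comp_word \<phi> w y) (comp_word \<phi> w (p y))"
      using dist_triangle[of "comp_word \<phi> w x" "comp_word \<phi> w y" "comp_word \<phi> w (p x)"]
        dist_triangle[of "comp_word \<phi> w (p x)" "comp_word \<phi> w y" "comp_word \<phi> w (p y)"]
      by (simp add: dist_commute)
    also have "\<dots> \<le> weight w * dist x (p x) + weight w * dist (p x) (p y) + weight w * dist y (p y)"
      by (intro add_mono dist_segment_le w seg Y pp)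
    also have "\<dots> \<le> weight w * (l / 2) + weight w * \<rho> + weight w * (l / 2)"
      using weight_pos[OF w] d dp Y by (intro add_mono mult_left_mono) auto
    finally show ?thesis by (simp add: algebra_simps)
  qed
  have "dist (comp_word \<phi> w x) (comp_word \<phi> w y) \<le> real (card k) * (weight w * (l + \<rho>))"
    if w: "w \<in> lists A" and xy: "x \<in> Y" "y \<in> Y" for w x y
  proof (rule connected_cover_dist_le[of "comp_word \<phi> w ` Y" k "\<lambda>z. comp_word \<phi> w ` E z"])
    show "connected (comp_word \<phi> w ` Y)"
      by (intro connected_continuous_image continuous_on_comp_word w connected)
    show "comp_word \<phi> w ` Y \<subseteq> (\<Union>z\<in>k. comp_word \<phi> w ` E z)" using cover by blast
  qed (use E[OF w] xy k in auto)
  moreover have "0 < real (card k)"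
    using k nonempty by (auto simp: card_gt_0_iff)
  ultimately show thesis
    using \<gamma>l(3) \<rho>(1)
    by (intro that[of "real (card k) * (l + \<rho>)"] mult_pos_pos) (auto simp: algebra_simps)
qed

text \<open>On one fixed ball in the interior, bounded distortion keeps the derivative above
  \<open>weight w / distortion\<^sup>2\<close>, so the image contains a proportional ball.\<close>

lemma ball_subset_image_interior:
  obtains c where "0 < c" "\<And>w. w \<in> lists A \<Longrightarrow> \<exists>z. ball z (c * weight w) \<subseteq> comp_word \<phi> w ` interior Y"
proof -
  obtain y where "y \<in> interior Y"
    using regular_closed nonempty by (metis closure_empty ex_in_conv)
  then obtain \<rho> where \<rho>: "0 < \<rho>" "ball y \<rho> \<subseteq> interior Y"
    by (metis open_contains_ball open_interior)
  have "\<exists>z. ball z (\<rho> / distortion\<^sup>2 * weight w) \<subseteq> comp_word \<phi> w ` interior Y" if w: "w \<in> lists A" for w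
  proof -
    have sub: "ball y \<rho> \<subseteq> Y" using \<rho> interior_subset by blast
    have eq: "comp_word \<Phi> w x = comp_word \<phi> w x" if "x \<in> ball y \<rho>" for x
      using comp_word_ext[OF w] sub that by blast
    have "ball (comp_word \<Phi> w y) (weight w / distortion\<^sup>2 * \<rho>) \<subseteq> comp_word \<Phi> w ` ball y \<rho>"
    proof (rule ball_subset_image_ball)
      have "inj_on (comp_word \<phi> w) (ball y \<rho>)"
        by (rule inj_on_subset[OF inj_on_comp_word[OF w] sub])
      then show "inj_on (comp_word \<Phi> w) (ball y \<rho>)"
        using eq by (simp add: inj_on_def)
      fix x assume "x \<in> ball y \<rho>"
      then have x: "x \<in> Y" using sub by blast
      then have "weight w / distortion\<^sup>2 \<le> word_scale w x"
        using weight_le_word_scale[OF w x] distortion_ge_1 by (simp add: divide_simps mult.commute)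
      then show "\<exists>c T. weight w / distortion\<^sup>2 \<le> c \<and> orthogonal_transformation T \<and>
          (comp_word \<Phi> w has_derivative (\<lambda>v. c *\<^sub>R T v)) (at x)"
        using comp_word_derivative[OF w x] by blast
    qed (use \<rho> weight_pos[OF w] distortion_ge_1 in auto)
    also have "\<dots> = comp_word \<phi> w ` ball y \<rho>" using eq by (rule image_cong[OF refl])
    also have "\<dots> \<subseteq> comp_word \<phi> w ` interior Y" using \<rho> by blast
    finally show ?thesis by (auto simp: mult.commute)
  qed
  then show thesis using that[of "\<rho> / distortion\<^sup>2"] \<rho>(1) distortion_ge_1 by simp
qed

text \<open>The image of \<open>Y\<close> has diameter at most
  \<open>s ^ length w * diameter Y\<close> but contains a ball of radius proportional to
  \<open>weight w\<close>.\<close>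

lemma weight_le_power:
  obtains C where "0 < C" "\<And>w. w \<in> lists A \<Longrightarrow> weight w \<le> C * s ^ length w"
proof -
  obtain c where c: "0 < c" "\<And>w. w \<in> lists A \<Longrightarrow> \<exists>z. ball z (c * weight w) \<subseteq> comp_word \<phi> w ` interior Y"
    using ball_subset_image_interior by blast
  have "weight w \<le> ((diameter Y + 1) / c) * s ^ length w" if w: "w \<in> lists A" for w
  proof -
    obtain z where z: "ball z (c * weight w) \<subseteq> comp_word \<phi> w ` Y"
      using c(2)[OF w] interior_subset[of Y] by blast
    have pos: "0 < c * weight w" using c weight_pos[OF w] by simp
    have bound: "dist a b \<le> s ^ length w * diameter Y" if "a \<in> comp_word \<phi> w ` Y" "b \<in> comp_word \<phi> w ` Y" for a b
    proof -
      obtain x y where xy: "x \<in> Y" "y \<in> Y" "a = comp_word \<phi> w x" "b = comp_word \<phi> w y" using \<open>a \<in> _\<close> \<open>b \<in> _\<close> by auto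
      have "dist a b \<le> s ^ length w * dist x y" using comp_word_dist[OF w xy(1,2)] xy by simp
      also have "\<dots> \<le> s ^ length w * diameter Y"
        using s xy by (intro mult_left_mono diameter_bounded_bound compact_imp_bounded compact) auto
      finally show ?thesis .
    qed
    have "diameter (ball z (c * weight w)) \<le> s ^ length w * diameter Y"
    proof (rule diameter_le)
      fix a b assume "a \<in> ball z (c * weight w)" "b \<in> ball z (c * weight w)"
      then show "norm (a - b) \<le> s ^ length w * diameter Y"
        using bound z by (simp only: dist_norm[symmetric] subset_iff)
    qed (use pos in simp)
    then have "c * weight w \<le> s ^ length w * diameter Y" using pos by simp
    also have "\<dots> \<le> s ^ length w * (diameter Y + 1)" using s by (intro mult_left_mono) auto
    finally show ?thesis using c by (simp add: divide_simps mult.commute)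
  qed
  moreover have "0 < (diameter Y + 1) / c" using c diameter_nonneg by simp
  ultimately show thesis using that by blast
qed

text \<open>Splitting the word around the letter costs two distortion factors, and the finitely many
  one-letter weights are comparable.\<close>

lemma weight_change_letter:
  obtains D where "1 \<le> D" "\<And>u v a b. u \<in> lists A \<Longrightarrow> v \<in> lists A \<Longrightarrow> a \<in> A \<Longrightarrow> b \<in> A \<Longrightarrow>
    weight (u @ a # v) \<le> D * weight (u @ b # v)"
proof -
  define m M where "m = Min ((\<lambda>a. weight [a]) ` A)" and "M = Max ((\<lambda>a. weight [a]) ` A)"
  have "A \<noteq> {}" using two_letters by auto
  then have m: "0 < m" and ab: "\<And>a. a \<in> A \<Longrightarrow> m \<le> weight [a] \<and> weight [a] \<le> M"
    using finite_A weight_pos by (auto simp: m_def M_def)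
  then have M: "0 < M" using \<open>A \<noteq> {}\<close> by fastforce
  define K where "K = distortion\<^sup>2"
  \<comment> \<open>\<open>1 \<le> D\<close> lets the same constant serve words that
    \<open>dec\<close> leaves unchanged.\<close>
  define D where "D = max 1 (K * K * (M / m))"
  have "weight (u @ a # v) \<le> D * weight (u @ b # v)"
    if uv: "u \<in> lists A" "v \<in> lists A" "a \<in> A" "b \<in> A" for u v a b
  proof -
    have pos: "0 < weight u" "0 < weight v" "0 < weight (u @ b # v)" using weight_pos[of u] weight_pos[of v] weight_pos[of "u @ b # v"] uv by auto
    have "0 < K" using distortion_ge_1 by (simp add: K_def)
    have "weight (u @ [a] @ v) \<le> weight u * weight ([a] @ v)"
      using uv by (intro weight_append_le) auto
    also have "\<dots> \<le> weight u * (weight [a] * weight v)"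
      using uv pos by (intro mult_left_mono weight_append_le) auto
    also have "\<dots> \<le> weight u * (M / m * weight [b] * weight v)"
    proof -
      have "weight [a] * m \<le> M * weight [b]" using ab[OF uv(3)] ab[OF uv(4)] m M by (intro mult_mono) auto
      then have "weight [a] \<le> M / m * weight [b]" using m by (simp add: divide_simps)
      then show ?thesis using pos by (intro mult_left_mono mult_right_mono) auto
    qed
    also have "\<dots> = M / m * (weight u * (weight [b] * weight v))" by simp
    also have "\<dots> \<le> M / m * (weight u * (K * weight ([b] @ v)))"
      using uv pos M m unfolding K_def by (intro mult_left_mono weight_append_ge) auto
    also have "\<dots> = K * (M / m) * (weight u * weight ([b] @ v))" by simp
    also have "\<dots> \<le> K * (M / m) * (K * weight (u @ [b] @ v))"
      using uv M m \<open>0 < K\<close> unfolding K_def[symmetric]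
      by (intro mult_left_mono weight_append_ge[folded K_def]) auto
    also have "\<dots> = K * K * (M / m) * weight (u @ b # v)" by simp
    also have "\<dots> \<le> D * weight (u @ b # v)"
      using pos by (intro mult_right_mono) (auto simp: D_def)
    finally show ?thesis by simp
  qed
  then show thesis using that[of D] by (auto simp: D_def)
qed

end

section \<open>Subshifts and partition sums\<close>

text \<open>Only prefixes are taken; for a shift-invariant \<open>X\<close> these are all blocks of
  length \<open>n\<close> occurring in \<open>X\<close>.\<close>

definition words :: "(nat \<Rightarrow> 'i) set \<Rightarrow> nat \<Rightarrow> 'i list set" where
  "words X n = (\<lambda>x. map x [0..<n]) ` X"

text \<open>The last condition says that \<open>X\<close> is closed in the product topology.\<close>

definition subshift :: "'i set \<Rightarrow> (nat \<Rightarrow> 'i) set \<Rightarrow> bool" where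
  "subshift A X \<longleftrightarrow> X \<noteq> {} \<and> (\<forall>x\<in>X. \<forall>n. x n \<in> A) \<and> (\<forall>x\<in>X. (\<lambda>n. x (Suc n)) \<in> X) \<and>
     (\<forall>x. (\<forall>n. map x [0..<n] \<in> words X n) \<longrightarrow> x \<in> X)"

lemma subshift_shift: "subshift A X \<Longrightarrow> x \<in> X \<Longrightarrow> (\<lambda>n. x (k + n)) \<in> X"
proof (induction k)
  case (Suc k)
  then have "(\<lambda>n. x (k + Suc n)) \<in> X" by (auto simp: subshift_def)
  then show ?case by simp
qed auto

lemma subshift_letter: "subshift A X \<Longrightarrow> x \<in> X \<Longrightarrow> x n \<in> A"
  by (simp add: subshift_def)

lemma subshift_closed: "subshift A X \<Longrightarrow> (\<And>n. map x [0..<n] \<in> words X n) \<Longrightarrow> x \<in> X"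
  by (simp add: subshift_def)

lemma words_lists: "subshift A X \<Longrightarrow> w \<in> words X n \<Longrightarrow> w \<in> lists A \<and> length w = n"
  by (auto simp: words_def subshift_letter)

lemma finite_words:
  assumes "finite A" "subshift A X"
  shows "finite (words X n)"
proof (rule finite_subset)
  show "words X n \<subseteq> {w. set w \<subseteq> A \<and> length w = n}" using words_lists[OF assms(2)] by fastforce
qed (rule finite_lists_length_eq[OF assms(1)])

lemma card_words_le:
  assumes "finite A" "subshift A X"
  shows "card (words X n) \<le> card A ^ n"
proof -
  have "card (words X n) \<le> card {w. set w \<subseteq> A \<and> length w = n}"
    using words_lists[OF assms(2)] by (intro card_mono finite_lists_length_eq assms) fastforce
  then show ?thesis by (simp add: card_lists_length_eq[OF assms(1)])
qed

lemma map_upt_append: "map x [0..<m + n] = map x [0..<m] @ map (\<lambda>k. x (m + k)) [0..<n]"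
  by (induction n) auto

text \<open>Compactness of \<open>X\<close>: if no \<open>N\<close> works, a prefix that is bad for
  every \<open>N\<close> can be prolonged letter by letter, and the limit sequence belongs to the
  closed set \<open>X\<close>.\<close>

lemma koenig:
  assumes "finite A" "subshift A X" and P: "\<And>x. x \<in> X \<Longrightarrow> \<exists>n. map x [0..<n] \<in> P"
  obtains N where "\<And>x. x \<in> X \<Longrightarrow> \<exists>n\<le>N. map x [0..<n] \<in> P"
proof (rule ccontr)
  assume none: "\<not> thesis"
  define bad where "bad w \<longleftrightarrow> (\<forall>N. \<exists>x\<in>X. map x [0..<length w] = w \<and> (\<forall>n\<le>N. map x [0..<n] \<notin> P))" for w
  have bad_Nil: "bad []" 
  proof (rule ccontr)
    assume "\<not> bad []"
    then obtain N where "\<And>x. x \<in> X \<Longrightarrow> \<exists>n\<le>N. map x [0..<n] \<in> P" by (auto simp: bad_def)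
    then show False using none that by blast
  qed
  have step: "\<exists>a. bad (w @ [a])" if w: "bad w" for w
  proof (rule ccontr)
    assume "\<not> ?thesis"
    then have "\<forall>a. \<exists>N. \<forall>x\<in>X. map x [0..<Suc (length w)] = w @ [a] \<longrightarrow> (\<exists>n\<le>N. map x [0..<n] \<in> P)"
      unfolding bad_def by (auto simp del: upt_Suc)
    then obtain N where N: "\<And>a x. x \<in> X \<Longrightarrow> map x [0..<Suc (length w)] = w @ [a] \<Longrightarrow> \<exists>n\<le>N a. map x [0..<n] \<in> P"
      by metis
    \<comment> \<open>If every one-letter extension had a bound, the maximum over the finite
      alphabet would bound \<open>w\<close> itself.\<close>
    obtain x where x: "x \<in> X" "map x [0..<length w] = w" "\<forall>n\<le>Max (N ` A). map x [0..<n] \<notin> P"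
      using w unfolding bad_def by blast
    have "x (length w) \<in> A" by (rule subshift_letter[OF assms(2) x(1)])
    then have "N (x (length w)) \<le> Max (N ` A)" using \<open>finite A\<close> by auto
    then show False using N[of x "x (length w)"] x by (auto dest: order_trans)
  qed
  then obtain g where g: "\<And>w. bad w \<Longrightarrow> bad (w @ [g w])" by metis
  define f where "f = rec_nat [] (\<lambda>_ w. w @ [g w])"
  have f: "f 0 = []" "f (Suc n) = f n @ [g (f n)]" for n by (simp_all add: f_def)
  have bad_f: "bad (f n)" for n by (induction n) (auto simp: f bad_Nil g)
  define x where "x n = g (f n)" for n
  have map_x: "map x [0..<n] = f n" for n by (induction n) (auto simp: f x_def)
  have len: "length (f n) = n" for n by (induction n) (auto simp: f)
  have "map x [0..<n] \<in> words X n" for n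
    using bad_f[of n] unfolding bad_def words_def len map_x by (auto simp: image_iff; metis)
  then have "x \<in> X" by (rule subshift_closed[OF assms(2)])
  \<comment> \<open>Badness of the prefix of length \<open>n\<close>, used with bound
    \<open>n\<close>, yields a sequence agreeing with \<open>x\<close> up to \<open>n\<close> but
    without prefixes in \<open>P\<close> there.\<close>
  then obtain n where "map x [0..<n] \<in> P" using P by blast
  moreover obtain y where "map y [0..<n] = f n" "\<forall>k\<le>n. map y [0..<k] \<notin> P"
    using bad_f[of n] unfolding bad_def len by blast
  ultimately show False using map_x[of n] by auto
qed

section \<open>The coding map, and null measure from small partition sums\<close>

context CIFS_derivative
begin

text \<open>Nested compact images with diameters tending to 0 meet in one point, which gives
  \<open>the_elem\<close> its meaning.\<close>

lemma coding_map_in: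
  assumes "\<And>n. \<omega> n \<in> A"
  shows "coding_map Y \<phi> \<omega> \<in> comp_word \<phi> (map \<omega> [0..<n]) ` Y"
proof -
  define F where "F n = comp_word \<phi> (map \<omega> [0..<n]) ` Y" for n
  have lists: "map \<omega> [0..<n] \<in> lists A" for n using assms by auto
  have dec: "F n \<subseteq> F m" if "m \<le> n" for m n
  proof -
    have "F n = comp_word \<phi> (map \<omega> [0..<m]) ` comp_word \<phi> (map (\<lambda>k. \<omega> (m + k)) [0..<n - m]) ` Y"
      using map_upt_append[of \<omega> m "n - m"] that by (simp add: F_def comp_word_append image_comp)
    also have "\<dots> \<subseteq> F m"
      unfolding F_def using assms by (intro image_mono image_subsetI comp_word_in) auto
    finally show ?thesis .
  qed
  have "\<Inter>(range F) \<noteq> {}"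
    by (rule compact_nest) (use dec nonempty in \<open>auto simp: F_def intro!: compact_continuous_image continuous_on_comp_word lists compact\<close>)
  then obtain p where p: "\<And>n. p \<in> F n" by blast
  \<comment> \<open>Only levels \<open>n \<ge> 1\<close> are assumed, as in the intersection
    defining \<open>coding_map\<close>.\<close>
  have uniq: "q = p" if q: "\<And>n. n \<ge> 1 \<Longrightarrow> q \<in> F n" for q
  proof -
    have le: "dist q p \<le> s ^ n * diameter Y" if n: "n \<ge> 1" for n
    proof -
      obtain x y where xy: "x \<in> Y" "y \<in> Y" "q = comp_word \<phi> (map \<omega> [0..<n]) x" "p = comp_word \<phi> (map \<omega> [0..<n]) y"
        using q[OF n] p[of n] by (auto simp: F_def)
      have "dist q p \<le> s ^ n * dist x y" using comp_word_dist[OF lists[of n] xy(1,2)] xy by simp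
      also have "\<dots> \<le> s ^ n * diameter Y"
        using s xy by (intro mult_left_mono diameter_bounded_bound compact_imp_bounded compact) auto
      finally show ?thesis .
    qed
    have "(\<lambda>n. s ^ n * diameter Y) \<longlonglongrightarrow> 0 * diameter Y"
      using s by (intro tendsto_mult LIMSEQ_power_zero tendsto_const) auto
    then have "dist q p \<le> 0 * diameter Y"
      by (rule tendsto_lowerbound) (use le in \<open>auto simp: eventually_sequentially\<close>)
    then show ?thesis by simp
  qed
  have "(\<Inter>n\<in>{1..}. word_map \<phi> \<omega> n ` Y) = {p}"
    using p uniq by (auto simp: word_map_eq_comp_word F_def[symmetric])
  then show ?thesis using p by (simp add: coding_map_def F_def)
qed

text \<open>The sum called Z in the overview; its exponential growth rate in \<open>n\<close> is the
  pressure at exponent \<open>t\<close>.\<close>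

definition partition_sum :: "(nat \<Rightarrow> 'i) set \<Rightarrow> nat \<Rightarrow> real \<Rightarrow> real" where
  "partition_sum X n t = (\<Sum>w\<in>words X n. weight w powr t)"

lemma partition_sum_nonneg: "0 \<le> partition_sum X n t"
  by (simp add: partition_sum_def sum_nonneg)

lemma weight_append_powr_le:
  "u \<in> lists A \<Longrightarrow> v \<in> lists A \<Longrightarrow> 0 \<le> t \<Longrightarrow> weight (u @ v) powr t \<le> weight u powr t * weight v powr t"
  by (metis weight_append_le weight_pos powr_mono2 powr_mult append_in_lists_conv less_imp_le)

text \<open>A word of length \<open>m + n\<close> splits into two words of the shift-invariant
  \<open>X\<close>, and the weight is submultiplicative.\<close>

lemma partition_sum_add:
  assumes X: "subshift A X" and "0 \<le> t"
  shows "partition_sum X (m + n) t \<le> partition_sum X m t * partition_sum X n t"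
proof -
  let ?P = "words X m \<times> words X n" and ?f = "\<lambda>w. weight w powr t"
  have fin: "finite ?P" using finite_words[OF finite_A X] by blast
  have "words X (m + n) \<subseteq> (\<lambda>(u, v). u @ v) ` ?P"
  proof
    fix w assume "w \<in> words X (m + n)"
    then obtain x where x: "x \<in> X" "w = map x [0..<m + n]" by (auto simp: words_def)
    have "map x [0..<m] \<in> words X m" "map (\<lambda>k. x (m + k)) [0..<n] \<in> words X n"
      using x subshift_shift[OF X x(1), of m] by (auto simp: words_def)
    then show "w \<in> (\<lambda>(u, v). u @ v) ` ?P" using x map_upt_append by force
  qed
  then have "partition_sum X (m + n) t \<le> sum ?f ((\<lambda>(u, v). u @ v) ` ?P)"
    unfolding partition_sum_def using fin by (intro sum_mono2) auto
  also have "\<dots> \<le> (\<Sum>(u, v)\<in>?P. ?f (u @ v))"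
    using sum_image_le[OF fin, of ?f "\<lambda>(u, v). u @ v"] by (simp add: o_def case_prod_unfold)
  also have "\<dots> \<le> (\<Sum>(u, v)\<in>?P. ?f u * ?f v)"
    using words_lists[OF X] assms by (intro sum_mono) (auto intro!: weight_append_powr_le)
  also have "\<dots> = partition_sum X m t * partition_sum X n t"
    by (simp add: partition_sum_def sum_product sum.cartesian_product)
  finally show ?thesis .
qed

text \<open>Only positive multiples occur: the sum at length 0 is \<open>distortion powr t\<close>,
  which may exceed 1.\<close>

lemma partition_sum_mult:
  assumes "subshift A X" "0 \<le> t"
  shows "partition_sum X (n * Suc k) t \<le> partition_sum X n t ^ Suc k"
proof (induction k)
  case (Suc k)
  have "partition_sum X (n * Suc (Suc k)) t \<le> partition_sum X n t * partition_sum X (n * Suc k) t"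
    using partition_sum_add[OF assms, of n "n * Suc k"] by simp
  also have "\<dots> \<le> partition_sum X n t * partition_sum X n t ^ Suc k"
    by (intro mult_left_mono Suc partition_sum_nonneg)
  finally show ?case by simp
qed auto

text \<open>Submultiplicativity turns one sum below 1 into exponential decay along multiples of
  \<open>n\<close>, and the images of \<open>Y\<close> under words of these lengths cover the limit
  set.\<close>

lemma hausdorff_measure_limit_set_eq_0:
  assumes X: "subshift A X" and "0 \<le> t" "1 \<le> n" and less: "partition_sum X n t < 1"
  shows "hausdorff_measure t (limit_set Y \<phi> X) = 0"
proof (rule hausdorff_measure_eq_0I)
  have "words X n \<noteq> {}" using X by (auto simp: subshift_def words_def)
  then have card: "1 \<le> card (words X n)"
    using finite_words[OF finite_A X] by (simp add: Suc_le_eq card_gt_0_iff)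
  \<comment> \<open>For \<open>t = 0\<close> every term is 1, so the sum could not be below
    1.\<close>
  show "0 < t"
  proof (rule ccontr)
    assume "\<not> 0 < t"
    then have "partition_sum X n t = (\<Sum>w\<in>words X n. 1)"
      unfolding partition_sum_def using \<open>0 \<le> t\<close> weight_pos words_lists[OF X]
      by (intro sum.cong) (auto simp: less_imp_neq[symmetric] dest!: weight_pos)
    then show False using less card by simp
  qed
  fix \<delta> \<epsilon> :: real assume "0 < \<delta>" "0 < \<epsilon>"
  define z where "z = partition_sum X n t"
  have z: "0 \<le> z" "z < 1" using less by (auto simp: z_def partition_sum_nonneg)
  obtain C where C: "0 < C" "\<And>w x y. w \<in> lists A \<Longrightarrow> x \<in> Y \<Longrightarrow> y \<in> Y \<Longrightarrow>
      dist (comp_word \<phi> w x) (comp_word \<phi> w y) \<le> C * weight w"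
    using dist_le_weight by blast
  have "(\<lambda>k. s ^ k * diameter Y) \<longlonglongrightarrow> 0 * diameter Y" "(\<lambda>k. C powr t * z ^ k) \<longlonglongrightarrow> C powr t * 0"
    using s z by (intro tendsto_mult LIMSEQ_power_zero tendsto_const; simp)+
  then have "\<forall>\<^sub>F k in sequentially. s ^ k * diameter Y < \<delta> \<and> C powr t * z ^ k < \<epsilon>"
    using \<open>0 < \<delta>\<close> \<open>0 < \<epsilon>\<close> by (intro eventually_conj order_tendstoD) auto
  then obtain k where k: "s ^ k * diameter Y < \<delta>" "C powr t * z ^ k < \<epsilon>"
    by (auto simp: eventually_sequentially)
  \<comment> \<open>A multiple of \<open>n\<close> that is at least \<open>k\<close>, so that both
    the diameter bound and the sum bound apply.\<close>
  define m where "m = n * Suc k"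
  define U where "U w = comp_word \<phi> w ` Y" for w
  have "k \<le> m" using \<open>1 \<le> n\<close> mult_le_mono[of 1 n k "Suc k"] by (simp add: m_def)
  have w: "w \<in> lists A" "length w = m" if "w \<in> words X m" for w using words_lists[OF X that] by auto
  have bounded: "bounded (U w)" if "w \<in> words X m" for w
    unfolding U_def
    by (intro compact_imp_bounded compact_continuous_image continuous_on_comp_word w[OF that] compact)
  have "limit_set Y \<phi> X \<subseteq> (\<Union>w\<in>words X m. U w)"
    unfolding limit_set_def words_def U_def using coding_map_in subshift_letter[OF X] by fastforce
  moreover have "diameter (U w) \<le> \<delta>" if "w \<in> words X m" for w
  proof (rule diameter_le)
    show "U w \<noteq> {} \<or> 0 \<le> \<delta>" using \<open>0 < \<delta>\<close> by simp
    fix a b assume "a \<in> U w" "b \<in> U w"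
    then obtain x y where xy: "x \<in> Y" "y \<in> Y" "a = comp_word \<phi> w x" "b = comp_word \<phi> w y" by (auto simp: U_def)
    have "dist a b \<le> s ^ m * dist x y" using comp_word_dist[OF w(1)[OF that] xy(1,2)] xy w(2)[OF that] by simp
    also have "\<dots> \<le> s ^ k * diameter Y"
      using s xy \<open>k \<le> m\<close>
      by (intro mult_mono power_decreasing diameter_bounded_bound compact_imp_bounded compact) auto
    finally show "norm (a - b) \<le> \<delta>" using k by (simp add: dist_norm)
  qed
  moreover have "(\<Sum>w\<in>words X m. diameter (U w) powr t) \<le> \<epsilon>"
  proof -
    have diam: "diameter (U w) \<le> C * weight w" if "w \<in> words X m" for w
    proof (rule diameter_le)
      show "U w \<noteq> {} \<or> 0 \<le> C * weight w" using nonempty by (simp add: U_def)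
      fix a b assume "a \<in> U w" "b \<in> U w"
      then show "norm (a - b) \<le> C * weight w"
        using C(2)[OF w(1)[OF that]] by (auto simp: U_def dist_norm)
    qed
    have "(\<Sum>w\<in>words X m. diameter (U w) powr t) \<le> (\<Sum>w\<in>words X m. (C * weight w) powr t)"
      using \<open>0 \<le> t\<close> diam bounded by (intro sum_mono powr_mono2 diameter_ge_0) auto
    also have "\<dots> = C powr t * partition_sum X m t"
      unfolding partition_sum_def sum_distrib_left using C weight_pos w(1)
      by (intro sum.cong) (auto simp: powr_mult less_imp_le)
    also have "\<dots> \<le> C powr t * z ^ Suc k"
      unfolding m_def z_def by (intro mult_left_mono partition_sum_mult assms) auto
    also have "\<dots> \<le> C powr t * z ^ k" using z by (intro mult_left_mono power_decreasing) auto
    finally show ?thesis using k by simp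
  qed
  ultimately show "\<exists>I U. finite (I :: 'i list set) \<and> limit_set Y \<phi> X \<subseteq> (\<Union>i\<in>I. U i)
      \<and> (\<forall>i\<in>I. bounded (U i) \<and> diameter (U i) \<le> \<delta>) \<and> (\<Sum>i\<in>I. diameter (U i) powr t) \<le> \<epsilon>"
    using finite_words[OF finite_A X] bounded by (intro exI[of _ "words X m"] exI[of _ U]) auto
qed

text \<open>The surplus exponent \<open>u - t\<close> is spent on the uniform decay
  \<open>weight w \<le> C * s ^ length w\<close>.\<close>

lemma partition_sum_le_power:
  assumes X: "subshift A X" and "t \<le> u"
  obtains C where "0 < C" "\<And>n. partition_sum X n u \<le> C * (s powr (u - t)) ^ n * partition_sum X n t"
proof -
  obtain C where C: "0 < C" "\<And>w. w \<in> lists A \<Longrightarrow> weight w \<le> C * s ^ length w"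
    using weight_le_power by blast
  have "partition_sum X n u \<le> C powr (u - t) * (s powr (u - t)) ^ n * partition_sum X n t" for n
    unfolding partition_sum_def sum_distrib_left
  proof (rule sum_mono)
    fix w assume "w \<in> words X n"
    then have w: "w \<in> lists A" "length w = n" using words_lists[OF X] by auto
    have "weight w powr u = weight w powr (u - t) * weight w powr t" by (simp flip: powr_add)
    also have "\<dots> \<le> (C * s ^ n) powr (u - t) * weight w powr t"
      using C(2)[OF w(1)] w weight_pos[OF w(1)] assms by (intro mult_right_mono powr_mono2) auto
    also have "(C * s ^ n) powr (u - t) = C powr (u - t) * (s powr (u - t)) ^ n"
      using C s by (simp add: powr_mult powr_power flip: powr_realpow) (simp add: powr_powr mult.commute)
    finally show "weight w powr u \<le> C powr (u - t) * (s powr (u - t)) ^ n * weight w powr t" .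
  qed
  then show thesis using that[of "C powr (u - t)"] C by simp
qed

text \<open>For a large exponent the decay of the weights beats the number of words, at most
  \<open>card A ^ n\<close>.\<close>

lemma null_exponent:
  assumes X: "subshift A X"
  obtains u where "0 \<le> u" "hausdorff_measure u (limit_set Y \<phi> X) = 0"
proof -
  have A: "0 < card A" using two_letters finite_A by (auto simp: card_gt_0_iff)
  have "(\<lambda>k. s ^ k) \<longlonglongrightarrow> 0" using s by (intro LIMSEQ_power_zero) auto
  then have "\<forall>\<^sub>F k in sequentially. s ^ k < 1 / (2 * card A)"
    by (rule order_tendstoD) (use A in auto)
  \<comment> \<open>One letter multiplies the number of words by at most \<open>card A\<close> and
    the bound on weights to the power \<open>k\<close> by \<open>s ^ k\<close>; the product is below
    1/2.\<close>
  then obtain k where k: "s ^ k < 1 / (2 * card A)" by (auto simp: eventually_sequentially)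
  define u where "u = real k"
  obtain C where C: "0 < C" "\<And>n. partition_sum X n u \<le> C * (s powr (u - 0)) ^ n * partition_sum X n 0"
    using partition_sum_le_power[OF X, of 0 u] by (auto simp: u_def)
  have "(\<lambda>n. C * (1 / 2) ^ n) \<longlonglongrightarrow> C * 0" by (intro tendsto_mult LIMSEQ_power_zero) auto
  then have "\<forall>\<^sub>F n in sequentially. C * (1 / 2) ^ n < 1 \<and> 1 \<le> n"
    by (intro eventually_conj order_tendstoD eventually_ge_at_top) auto
  then obtain n where n: "C * (1 / 2) ^ n < 1" "1 \<le> n" by (auto simp: eventually_sequentially)
  have "partition_sum X n 0 \<le> real (card (words X n))"
    unfolding partition_sum_def using sum_mono[of "words X n" "\<lambda>w. weight w powr 0" "\<lambda>_. 1"] by simp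
  also have "\<dots> \<le> real (card A) ^ n"
    using card_words_le[OF finite_A X, of n] by (metis of_nat_le_iff of_nat_power)
  finally have le: "partition_sum X n 0 \<le> real (card A) ^ n" .
  have "partition_sum X n u \<le> C * (s ^ k) ^ n * partition_sum X n 0"
    using C(2)[of n] s by (simp add: u_def powr_realpow)
  also have "\<dots> \<le> C * (1 / (2 * card A)) ^ n * real (card A) ^ n"
    using C s k le by (intro mult_mono power_mono) (auto simp: partition_sum_nonneg)
  also have "\<dots> = C * (1 / 2) ^ n" using A by (simp add: power_divide power_mult_distrib)
  finally have "partition_sum X n u < 1" using n by simp
  then show thesis
    using hausdorff_measure_limit_set_eq_0[OF X _ n(2)] by (intro that[of u]) (auto simp: u_def)
qed

section \<open>Stopping words, and decay of partition sums above the dimension\<close>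

definition stops :: "real \<Rightarrow> 'i list \<Rightarrow> bool" where
  "stops r w \<longleftrightarrow> w \<noteq> [] \<and> weight w \<le> r \<and> (\<forall>k<length w. r < weight (take k w))"

text \<open>\<open>stops\<close> cuts a sequence at its first prefix of weight at most
  \<open>r\<close>. Weights decay exponentially, so the cut exists; it is not empty because
  \<open>weight [] = distortion\<close> is at least 1.\<close>

lemma stops_exists:
  assumes "\<And>n. x n \<in> A" "0 < r" "r < 1"
  shows "\<exists>n. stops r (map x [0..<n])"
proof -
  obtain C where C: "0 < C" "\<And>w. w \<in> lists A \<Longrightarrow> weight w \<le> C * s ^ length w"
    using weight_le_power by blast
  have "(\<lambda>n. C * s ^ n) \<longlonglongrightarrow> C * 0" using s by (intro tendsto_mult LIMSEQ_power_zero) auto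
  then have "\<forall>\<^sub>F n in sequentially. C * s ^ n < r" by (rule order_tendstoD) (use assms in auto)
  then obtain n where n: "C * s ^ n < r" by (auto simp: eventually_sequentially)
  define P where "P n \<longleftrightarrow> weight (map x [0..<n]) \<le> r" for n
  have "P n" using C(2)[of "map x [0..<n]"] n assms by (fastforce simp: P_def)
  then have P: "P (LEAST n. P n)" by (rule LeastI)
  have "weight [] = distortion" by (simp add: weight_def)
  then have "\<not> P 0" using distortion_ge_1 assms by (simp add: P_def)
  then have "0 < (LEAST n. P n)" using P by (metis gr0I)
  moreover have "r < weight (take k (map x [0..<LEAST n. P n]))" if "k < (LEAST n. P n)" for k
    using not_less_Least[OF that] that by (simp add: P_def take_map)
  ultimately have "stops r (map x [0..<LEAST n. P n])"
    using P by (auto simp: stops_def P_def)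
  then show ?thesis by blast
qed

text \<open>All proper prefixes of a stopping word have weight above \<open>r\<close>, so none of
  them stops.\<close>

lemma stops_parallel:
  assumes "stops r u" "stops r v" "u \<noteq> v"
  shows "u \<parallel> v"
proof -
  have "\<not> strict_prefix u v" if uv: "stops r u" "stops r v" for u v
  proof
    assume "strict_prefix u v"
    then obtain z where "v = u @ z" "z \<noteq> []" by (auto simp: strict_prefix_def prefix_def)
    then have "take (length u) v = u" "length u < length v" by auto
    then show False using uv unfolding stops_def by (metis not_less)
  qed
  then show ?thesis using assms by (metis parallelI strict_prefixI)
qed

lemma stops_disjoint:
  assumes "u \<in> lists A" "v \<in> lists A" "stops r u" "stops r v" "u \<noteq> v"
  shows "comp_word \<phi> u ` interior Y \<inter> comp_word \<phi> v ` interior Y = {}"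
proof -
  obtain p a u' b v' where "a \<noteq> b" "u = p @ a # u'" "v = p @ b # v'"
    using parallel_decomp[OF stops_parallel[OF assms(3-5)]] by blast
  then show ?thesis using assms comp_word_interior_disjoint by simp
qed

text \<open>Without its last letter the word still has weight above \<open>r\<close>, and one letter
  costs only a bounded factor.\<close>

lemma stops_weight_ge:
  obtains \<eta> where "0 < \<eta>" "\<And>r w. w \<in> lists A \<Longrightarrow> stops r w \<Longrightarrow> 0 < r \<Longrightarrow> \<eta> * r \<le> weight w"
proof -
  define m where "m = Min ((\<lambda>a. weight [a]) ` A)"
  have "A \<noteq> {}" using two_letters by auto
  then have m: "0 < m" "\<And>a. a \<in> A \<Longrightarrow> m \<le> weight [a]"
    using finite_A weight_pos by (auto simp: m_def)
  have "m / distortion\<^sup>2 * r \<le> weight w" if w: "w \<in> lists A" "stops r w" and "0 < r" for r w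
  proof -
    obtain v a where va: "w = v @ [a]" using w by (metis rev_exhaust stops_def)
    then have A: "v \<in> lists A" "a \<in> A" using w by auto
    have "r < weight (take (length v) w)" using w(2) va unfolding stops_def by auto
    then have "r * m \<le> weight v * weight [a]"
      using m A va \<open>0 < r\<close> weight_pos[OF A(1)] by (intro mult_mono) auto
    also have "\<dots> \<le> distortion\<^sup>2 * weight w"
      unfolding va using A by (intro weight_append_ge) auto
    finally show ?thesis using distortion_ge_1 by (simp add: divide_simps mult.commute)
  qed
  then show thesis using that[of "m / distortion\<^sup>2"] m distortion_ge_1 by simp
qed

text \<open>
  The images of the interior under the stopping words meeting a set of diameter at most \<open>r\<close> are
  disjoint, contain balls of radius comparable to \<open>r\<close> and lie in one such ball.
\<close>

lemma card_stops_le: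
  obtains M :: nat where "\<And>U r. 0 < r \<Longrightarrow> bounded U \<Longrightarrow> diameter U \<le> r \<Longrightarrow>
    finite {w \<in> lists A. stops r w \<and> comp_word \<phi> w ` Y \<inter> U \<noteq> {}} \<and>
    card {w \<in> lists A. stops r w \<and> comp_word \<phi> w ` Y \<inter> U \<noteq> {}} \<le> M"
proof -
  obtain C where C: "0 < C" "\<And>w x y. w \<in> lists A \<Longrightarrow> x \<in> Y \<Longrightarrow> y \<in> Y \<Longrightarrow>
      dist (comp_word \<phi> w x) (comp_word \<phi> w y) \<le> C * weight w"
    using dist_le_weight by blast
  obtain c where c: "0 < c" "\<And>w. w \<in> lists A \<Longrightarrow> \<exists>z. ball z (c * weight w) \<subseteq> comp_word \<phi> w ` interior Y"
    using ball_subset_image_interior by blast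
  obtain \<eta> where \<eta>: "0 < \<eta>" "\<And>r w. w \<in> lists A \<Longrightarrow> stops r w \<Longrightarrow> 0 < r \<Longrightarrow> \<eta> * r \<le> weight w"
    using stops_weight_ge by blast
  obtain z where z: "\<And>w. w \<in> lists A \<Longrightarrow> ball (z w) (c * weight w) \<subseteq> comp_word \<phi> w ` interior Y"
    using c(2) by metis
  \<comment> \<open>The volume ratio of balls of radii \<open>(C + 2) * r\<close> and
    \<open>c * \<eta> * r\<close>, rounded up; the scale cancels.\<close>
  define M where "M = nat \<lceil>((C + 2) / (c * \<eta>)) ^ DIM('a)\<rceil>"
  have "finite S \<and> card S \<le> M"
    if r: "0 < r" and U: "bounded U" "diameter U \<le> r"
      and S: "S = {w \<in> lists A. stops r w \<and> comp_word \<phi> w ` Y \<inter> U \<noteq> {}}" for U r S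
  \<comment> \<open>A uniform bound for all finite subsets yields finiteness as well.\<close>
  proof (rule finite_if_finite_subsets_card_bdd)
    fix F assume F: "F \<subseteq> S" "finite F"
    show "card F \<le> M"
    proof (cases "F = {}")
      case False
      then obtain q where "q \<in> U" using F S by auto
      let ?b = "\<lambda>w. ball (z w) (c * \<eta> * r)"
      have sub_int: "?b w \<subseteq> comp_word \<phi> w ` interior Y" if "w \<in> F" for w
      proof -
        have w: "w \<in> lists A" "stops r w" using that F S by auto
        have "c * \<eta> * r \<le> c * weight w" using \<eta>(2)[OF w r] c by (simp add: mult.assoc)
        then have "?b w \<subseteq> ball (z w) (c * weight w)" by (intro subset_ball)
        then show ?thesis using z[OF w(1)] by blast
      qed
      \<comment> \<open>From \<open>q\<close> to a point of \<open>U\<close> in the image is at most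
        \<open>r\<close>, and across the image at most \<open>C * r\<close>; \<open>C + 2\<close>
        leaves room for an open ball.\<close>
      have sub: "?b w \<subseteq> ball q ((C + 2) * r)" if F_w: "w \<in> F" for w
      proof
        fix a assume "a \<in> ?b w"
        then obtain x where x: "x \<in> Y" "a = comp_word \<phi> w x" using sub_int[OF F_w] interior_subset[of Y] by blast
        have w: "w \<in> lists A" "weight w \<le> r" "comp_word \<phi> w ` Y \<inter> U \<noteq> {}" using that F S by (auto simp: stops_def)
        then obtain y where y: "y \<in> Y" "comp_word \<phi> w y \<in> U" by auto
        have "dist q a \<le> dist q (comp_word \<phi> w y) + dist (comp_word \<phi> w y) a" by (rule dist_triangle)
        also have "dist q (comp_word \<phi> w y) \<le> r"
          using diameter_bounded_bound[OF U(1) \<open>q \<in> U\<close> y(2)] U(2) by simp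
        also have "dist (comp_word \<phi> w y) a \<le> C * weight w" using C(2)[OF w(1) y(1) x(1)] x by simp
        also have "C * weight w \<le> C * r" using C w by simp
        finally show "a \<in> ball q ((C + 2) * r)" using r by (simp add: algebra_simps)
      qed
      have disj: "pairwise (\<lambda>u v. disjnt (?b u) (?b v)) F"
      proof (rule pairwiseI)
        fix u v assume uv: "u \<in> F" "v \<in> F" "u \<noteq> v"
        then have "u \<in> lists A" "v \<in> lists A" "stops r u" "stops r v" using F S by auto
        from stops_disjoint[OF this uv(3)] show "disjnt (?b u) (?b v)"
          using sub_int[OF uv(1)] sub_int[OF uv(2)] unfolding disjnt_def by blast
      qed
      define V where "V = unit_ball_vol (real DIM('a))"
      have "real (card F) * (V * (c * \<eta> * r) ^ DIM('a)) = (\<Sum>w\<in>F. measure lebesgue (?b w))"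
        using c \<eta> r by (simp add: content_ball V_def)
      also have "\<dots> = measure lebesgue (\<Union>w\<in>F. ?b w)"
        by (rule measure_UNION'[symmetric]) (use F disj in auto)
      also have "\<dots> \<le> measure lebesgue (ball q ((C + 2) * r))"
        using F sub by (intro measure_mono_fmeasurable) auto
      also have "\<dots> = V * ((C + 2) * r) ^ DIM('a)"
        using C r by (simp add: content_ball V_def)
      finally have "real (card F) * (c * \<eta> * r) ^ DIM('a) \<le> ((C + 2) * r) ^ DIM('a)"
        using unit_ball_vol_pos[of "real DIM('a)"] by (simp add: V_def)
      then have "real (card F) \<le> ((C + 2) / (c * \<eta>)) ^ DIM('a)"
        using c \<eta> r by (simp add: divide_simps power_mult_distrib power_divide)
      then show ?thesis unfolding M_def by linarith
    qed auto
  qed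
  then show thesis by (rule that) auto
qed

text \<open>Each set of an efficient cover of the limit set is replaced by the boundedly many
  stopping words at its own scale whose images meet it. Every sequence of \<open>X\<close> has a
  prefix among these, and compactness reduces them to finitely many.\<close>

lemma finite_prefix_cover:
  assumes X: "subshift A X" and dim: "hausdorff_dim (limit_set Y \<phi> X) < t"
  obtains F where "finite F" "F \<subseteq> lists A" "[] \<notin> F" "\<And>x. x \<in> X \<Longrightarrow> \<exists>n. map x [0..<n] \<in> F"
    "(\<Sum>w\<in>F. weight w powr t) \<le> 1 / 2" "0 < t"
proof -
  obtain u where "0 \<le> u" "hausdorff_measure u (limit_set Y \<phi> X) = 0"
    using null_exponent[OF X] by blast
  then obtain s' where s': "0 \<le> s'" "s' < t" "hausdorff_measure s' (limit_set Y \<phi> X) = 0"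
    using hausdorff_dim_lessD[OF dim] by blast
  then have "0 < t" by simp
  obtain M :: nat where M: "\<And>U r. 0 < r \<Longrightarrow> bounded U \<Longrightarrow> diameter U \<le> r \<Longrightarrow>
    finite {w \<in> lists A. stops r w \<and> comp_word \<phi> w ` Y \<inter> U \<noteq> {}} \<and>
    card {w \<in> lists A. stops r w \<and> comp_word \<phi> w ` Y \<inter> U \<noteq> {}} \<le> M"
    using card_stops_le by blast
  \<comment> \<open>Each covering set will give at most \<open>M\<close> words of weight at most
    \<open>r i\<close>, so this budget yields at most 1/2; the added 1 covers
    \<open>M = 0\<close>.\<close>
  have "0 < 1 / (2 * (real M + 1))" by simp
  then obtain U r where U: "limit_set Y \<phi> X \<subseteq> (\<Union>i. U i)" "\<And>i :: nat. bounded (U i)" "\<And>i. diameter (U i) \<le> r i"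
    "\<And>i. 0 < r i" "\<And>i. r i < 1" "\<And>I. finite I \<Longrightarrow> (\<Sum>i\<in>I. r i powr t) \<le> 1 / (2 * (real M + 1))"
    using null_set_cover[OF s'(3,1,2) zero_less_one] by blast
  define S where "S i = {w \<in> lists A. stops (r i) w \<and> comp_word \<phi> w ` Y \<inter> U i \<noteq> {}}" for i
  have S: "finite (S i)" "card (S i) \<le> M" for i
    using M[OF U(4,2,3)] by (auto simp: S_def)
  have "\<exists>n. map x [0..<n] \<in> (\<Union>i. S i)" if x: "x \<in> X" for x
  proof -
    have "coding_map Y \<phi> x \<in> limit_set Y \<phi> X" using x by (simp add: limit_set_def)
    then obtain i where i: "coding_map Y \<phi> x \<in> U i" using U(1) by blast
    obtain n where "stops (r i) (map x [0..<n])"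
      using stops_exists[of x, OF subshift_letter[OF X x] U(4,5)] by blast
    moreover have "map x [0..<n] \<in> lists A" using subshift_letter[OF X x] by auto
    ultimately have "map x [0..<n] \<in> S i"
      using i coding_map_in[of x n, OF subshift_letter[OF X x]] unfolding S_def by blast
    then show ?thesis by blast
  qed
  then obtain N where N: "\<And>x. x \<in> X \<Longrightarrow> \<exists>n\<le>N. map x [0..<n] \<in> (\<Union>i. S i)"
    using koenig[OF finite_A X, of "\<Union>i. S i"] by blast
  define F where "F = {w \<in> (\<Union>i. S i). length w \<le> N}"
  have "F \<subseteq> {w. set w \<subseteq> A \<and> length w \<le> N}" by (auto simp: F_def S_def)
  then have fin: "finite F" using finite_lists_length_le[OF finite_A] by (rule finite_subset)
  have "\<forall>w\<in>F. \<exists>i. w \<in> S i" by (auto simp: F_def)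
  \<comment> \<open>Assigning each word to a single covering set lets the sum be grouped by covering
    sets.\<close>
  then obtain h where h: "\<And>w. w \<in> F \<Longrightarrow> w \<in> S (h w)" by metis
  have "(\<Sum>w\<in>F. weight w powr t) = (\<Sum>i\<in>h ` F. \<Sum>w\<in>{w \<in> F. h w = i}. weight w powr t)"
    by (rule sum.image_gen[OF fin])
  also have "\<dots> \<le> (\<Sum>i\<in>h ` F. real M * r i powr t)"
  proof (rule sum_mono)
    fix i
    have "(\<Sum>w\<in>{w \<in> F. h w = i}. weight w powr t) \<le> (\<Sum>w\<in>S i. weight w powr t)"
      using h S by (intro sum_mono2) auto
    also have "\<dots> \<le> (\<Sum>w\<in>S i. r i powr t)"
      using \<open>0 < t\<close> weight_pos by (intro sum_mono powr_mono2) (auto simp: S_def stops_def intro: less_imp_le)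
    also have "\<dots> \<le> real M * r i powr t"
      using S(2)[of i] by (simp add: mult_right_mono)
    finally show "(\<Sum>w\<in>{w \<in> F. h w = i}. weight w powr t) \<le> real M * r i powr t" .
  qed
  also have "\<dots> = real M * (\<Sum>i\<in>h ` F. r i powr t)" by (simp add: sum_distrib_left)
  also have "\<dots> \<le> real M * (1 / (2 * (real M + 1)))"
    using fin by (intro mult_left_mono U) auto
  also have "\<dots> \<le> 1 / 2" by (simp add: divide_simps)
  finally have sum: "(\<Sum>w\<in>F. weight w powr t) \<le> 1 / 2" .
  show thesis
  proof (rule that[OF fin _ _ _ sum \<open>0 < t\<close>])
    show "\<exists>n. map x [0..<n] \<in> F" if x: "x \<in> X" for x
    proof -
      obtain n where "n \<le> N" "map x [0..<n] \<in> (\<Union>i. S i)" using N[OF x] by blast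
      then show ?thesis by (auto simp: F_def)
    qed
  qed (auto simp: F_def S_def stops_def)
qed

text \<open>The first block from \<open>F\<close> is cut off; by shift invariance the remainder is
  again a word of \<open>X\<close>. Several cuts may be possible, hence an inequality.\<close>

lemma partition_sum_renewal:
  assumes X: "subshift A X" and F: "finite F" "F \<subseteq> lists A" "\<And>x. x \<in> X \<Longrightarrow> \<exists>n. map x [0..<n] \<in> F"
    and len: "\<And>w. w \<in> F \<Longrightarrow> length w \<le> n" and "0 \<le> t"
  shows "partition_sum X n t \<le> (\<Sum>f\<in>F. weight f powr t * partition_sum X (n - length f) t)"
proof -
  let ?P = "SIGMA f:F. words X (n - length f)" and ?g = "\<lambda>w. weight w powr t"
  have fin: "finite ?P" using F finite_words[OF finite_A X] by blast
  have "words X n \<subseteq> (\<lambda>(u, v). u @ v) ` ?P"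
  proof
    fix w assume "w \<in> words X n"
    then obtain x where x: "x \<in> X" "w = map x [0..<n]" by (auto simp: words_def)
    obtain m where m: "map x [0..<m] \<in> F" using F(3)[OF x(1)] by blast
    then have "m \<le> n" using len by force
    have "map (\<lambda>k. x (m + k)) [0..<n - m] \<in> words X (n - length (map x [0..<m]))"
      using subshift_shift[OF X x(1), of m] by (auto simp: words_def)
    moreover have "w = map x [0..<m] @ map (\<lambda>k. x (m + k)) [0..<n - m]"
      using map_upt_append[of x m "n - m"] x \<open>m \<le> n\<close> by simp
    ultimately show "w \<in> (\<lambda>(u, v). u @ v) ` ?P"
      using m by (intro image_eqI[where x = "(map x [0..<m], map (\<lambda>k. x (m + k)) [0..<n - m])"]) auto
  qed
  then have "partition_sum X n t \<le> sum ?g ((\<lambda>(u, v). u @ v) ` ?P)"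
    unfolding partition_sum_def using fin by (intro sum_mono2) auto
  also have "\<dots> \<le> (\<Sum>(u, v)\<in>?P. ?g (u @ v))"
    using sum_image_le[OF fin, of ?g "\<lambda>(u, v). u @ v"] by (simp add: o_def case_prod_unfold)
  also have "\<dots> \<le> (\<Sum>(u, v)\<in>?P. ?g u * ?g v)"
    using words_lists[OF X] F(2) \<open>0 \<le> t\<close> by (intro sum_mono) (auto intro!: weight_append_powr_le)
  also have "\<dots> = (\<Sum>f\<in>F. \<Sum>v\<in>words X (n - length f). ?g f * ?g v)"
    using F(1) finite_words[OF finite_A X] by (subst sum.Sigma) auto
  also have "\<dots> = (\<Sum>f\<in>F. ?g f * partition_sum X (n - length f) t)"
    by (simp add: partition_sum_def sum_distrib_left)
  finally show ?thesis .
qed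

text \<open>Strong induction through the renewal inequality; \<open>[] \<notin> F\<close> makes the
  remaining length strictly smaller.\<close>

lemma partition_sum_decay:
  assumes X: "subshift A X" and dim: "hausdorff_dim (limit_set Y \<phi> X) < t"
  obtains B q where "0 < B" "0 < q" "q < 1" "\<And>n. partition_sum X n t \<le> B * q ^ n" "0 < t"
proof -
  obtain F where F: "finite F" "F \<subseteq> lists A" "[] \<notin> F" "\<And>x. x \<in> X \<Longrightarrow> \<exists>n. map x [0..<n] \<in> F"
    "(\<Sum>w\<in>F. weight w powr t) \<le> 1 / 2" "0 < t"
    using finite_prefix_cover[OF assms] by blast
  define l where "l = Suc (\<Sum>f\<in>F. length f)"
  have l: "length f \<le> l" if "f \<in> F" for f
    using member_le_sum[OF that, of length] F(1) by (simp add: l_def)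
  \<comment> \<open>With \<open>q ^ l = 1 / 2\<close>, removing at most \<open>l\<close> letters
    raises \<open>q ^ n\<close> by a factor at most 2, which the total weight 1/2 of
    \<open>F\<close> compensates.\<close>
  define q :: real where "q = (1 / 2) powr (1 / l)"
  have "0 < real l" by (simp only: l_def of_nat_0_less_iff)
  then have q: "0 < q" "q < 1" using powr_less_mono2[of "1 / real l" "1 / 2" 1] by (auto simp: q_def)
  have ql: "q ^ l = 1 / 2" using \<open>0 < real l\<close> by (simp add: q_def powr_power)
  define B where "B = 1 + (\<Sum>m<l. partition_sum X m t)"
  have "0 < B" by (simp add: B_def add_pos_nonneg sum_nonneg partition_sum_nonneg)
  \<comment> \<open>The factor 2 covers \<open>n < l\<close>, where \<open>q ^ n\<close> is at least
    1/2.\<close>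
  have "partition_sum X n t \<le> 2 * B * q ^ n" for n
  proof (induction n rule: less_induct)
    case (less n)
    show ?case
    proof (cases "n < l")
      case True
      then have "partition_sum X n t \<le> (\<Sum>m<l. partition_sum X m t)"
        by (intro member_le_sum) (auto simp: partition_sum_nonneg)
      then have "partition_sum X n t \<le> 2 * B * (1 / 2)" by (simp add: B_def)
      also have "1 / 2 \<le> q ^ n" unfolding ql[symmetric] using q True by (intro power_decreasing) auto
      then have "2 * B * (1 / 2) \<le> 2 * B * q ^ n" using \<open>0 < B\<close> by (intro mult_left_mono) auto
      finally show ?thesis .
    next
      case False
      have "partition_sum X n t \<le> (\<Sum>f\<in>F. weight f powr t * partition_sum X (n - length f) t)"
        by (rule partition_sum_renewal[OF X F(1,2,4)]) (use l False F(6) in fastforce)+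
      also have "\<dots> \<le> (\<Sum>f\<in>F. weight f powr t * (4 * B * q ^ n))"
      proof (intro sum_mono mult_left_mono)
        fix f assume f: "f \<in> F"
        then have pos: "0 < length f" using F(3) by auto
        have "length f \<le> n" using l[OF f] False by simp
        have "partition_sum X (n - length f) t \<le> 2 * B * q ^ (n - length f)"
          using pos \<open>length f \<le> n\<close> by (intro less.IH) linarith
        also have "\<dots> \<le> 2 * B * (2 * q ^ n)"
        proof (intro mult_left_mono)
          have "q ^ l \<le> q ^ length f" using q l[OF f] by (intro power_decreasing) auto
          then have "q ^ (n - length f) * (1 / 2) \<le> q ^ (n - length f) * q ^ length f"
            unfolding ql using q by (intro mult_left_mono) auto
          also have "\<dots> = q ^ n" using \<open>length f \<le> n\<close> by (simp flip: power_add)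
          finally show "q ^ (n - length f) \<le> 2 * q ^ n" by simp
        qed (use \<open>0 < B\<close> in auto)
        finally show "partition_sum X (n - length f) t \<le> 4 * B * q ^ n" by simp
      qed auto
      also have "\<dots> = (\<Sum>f\<in>F. weight f powr t) * (4 * B * q ^ n)" by (simp add: sum_distrib_right)
      also have "\<dots> \<le> 1 / 2 * (4 * B * q ^ n)"
        using F(5) \<open>0 < B\<close> q by (intro mult_right_mono) auto
      finally show ?thesis by simp
    qed
  qed
  then show thesis using that[of "2 * B" q] q \<open>0 < B\<close> F(6) by simp
qed

end

section \<open>Admissible words of beta-shifts\<close>

text \<open>The value of the word as a base-\<beta> expansion after the point, in Horner
  form.\<close>

primrec val :: "real \<Rightarrow> nat list \<Rightarrow> real" where
  "val \<beta> [] = 0"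
| "val \<beta> (a # w) = (real a + val \<beta> w) / \<beta>"

primrec adm :: "real \<Rightarrow> nat list \<Rightarrow> bool" where
  "adm \<beta> [] \<longleftrightarrow> True"
| "adm \<beta> (a # w) \<longleftrightarrow> val \<beta> (a # w) < 1 \<and> adm \<beta> w"

text \<open>The weak inequality is what survives of \<open>adm\<close> when the base tends to
  \<beta>.\<close>

primrec weakly_adm :: "real \<Rightarrow> nat list \<Rightarrow> bool" where
  "weakly_adm \<beta> [] \<longleftrightarrow> True"
| "weakly_adm \<beta> (a # w) \<longleftrightarrow> val \<beta> (a # w) \<le> 1 \<and> weakly_adm \<beta> w"

text \<open>
  Decrements the last non-zero letter; truncated subtraction leaves words without such a letter
  unchanged.
\<close>

primrec dec :: "nat list \<Rightarrow> nat list" where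
  "dec [] = []"
| "dec (a # w) = (if set w \<subseteq> {0} then (a - 1) # w else a # dec w)"

lemma length_dec [simp]: "length (dec w) = length w"
  by (induction w) auto

lemma val_nonneg: "0 \<le> \<beta> \<Longrightarrow> 0 \<le> val \<beta> w"
  by (induction w) auto

lemma val_zeros: "set w \<subseteq> {0} \<Longrightarrow> val \<beta> w = 0"
  by (induction w) auto

lemma adm_zeros: "set w \<subseteq> {0} \<Longrightarrow> adm \<beta> w"
  by (induction w) (auto simp: val_zeros)

lemma adm_val_less: "adm \<beta> w \<Longrightarrow> val \<beta> w < 1"
  by (cases w) auto

lemma val_antimono: "0 < \<beta> \<Longrightarrow> \<beta> \<le> \<beta>' \<Longrightarrow> val \<beta>' w \<le> val \<beta> w"
proof (induction w)
  case (Cons a w)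
  then show ?case using val_nonneg[of \<beta>' w] by (auto intro!: frac_le)
qed auto

lemma adm_mono: "0 < \<beta> \<Longrightarrow> \<beta> \<le> \<beta>' \<Longrightarrow> adm \<beta> w \<Longrightarrow> adm \<beta>' w"
proof (induction w)
  case (Cons a w)
  then show ?case using val_antimono[of \<beta> \<beta>' "a # w"] by (auto simp del: val.simps)
qed auto

lemma val_append_zeros: "set z \<subseteq> {0} \<Longrightarrow> val \<beta> (w @ z) = val \<beta> w"
  by (induction w) (auto simp: val_zeros)

lemma adm_append_zeros: "set z \<subseteq> {0} \<Longrightarrow> adm \<beta> w \<Longrightarrow> adm \<beta> (w @ z)"
  by (induction w) (auto simp: adm_zeros val_append_zeros)

lemma val_append_ge: "0 < \<beta> \<Longrightarrow> val \<beta> w \<le> val \<beta> (w @ z)"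
  by (induction w) (auto simp: val_nonneg intro!: divide_right_mono)

lemma adm_appendD: "0 < \<beta> \<Longrightarrow> adm \<beta> (w @ z) \<Longrightarrow> adm \<beta> w \<and> adm \<beta> z"
proof (induction w)
  case (Cons a w)
  then show ?case using val_append_ge[of \<beta> "a # w" z] by (auto simp del: val.simps)
qed auto

lemma adm_letter_less:
  assumes "0 < \<beta>" "adm \<beta> w" "a \<in> set w"
  shows "real a < \<beta>"
  using assms(2,3)
proof (induction w)
  case (Cons b w)
  have "real b / \<beta> \<le> val \<beta> (b # w)"
    using val_nonneg[of \<beta> w] \<open>0 < \<beta>\<close> by (auto intro!: divide_right_mono)
  then have "real b / \<beta> < 1" using Cons by auto
  then show ?case using Cons \<open>0 < \<beta>\<close> by (auto simp: divide_simps split: if_splits)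
qed auto

lemma val_dec_less: "0 < \<beta> \<Longrightarrow> \<not> set w \<subseteq> {0} \<Longrightarrow> val \<beta> (dec w) < val \<beta> w"
proof (induction w)
  case (Cons a w)
  then show ?case by (cases "a = 0") (auto simp: val_zeros divide_strict_right_mono)
qed auto

text \<open>\<open>dec\<close> strictly lowers the value of each tail with a non-zero letter, and
  the other tails have value 0.\<close>

lemma adm_dec:
  assumes "0 < \<beta>" "weakly_adm \<beta> w"
  shows "adm \<beta> (dec w)"
  using assms(2)
proof (induction w)
  case (Cons a w)
  show ?case
  proof (cases "set w \<subseteq> {0}")
    case True
    then have "real a / \<beta> \<le> 1" using Cons by (simp add: val_zeros)
    then have "real (a - 1) / \<beta> < 1"
      using \<open>0 < \<beta>\<close> by (cases a) (auto simp: divide_simps)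
    then show ?thesis using True by (simp add: val_zeros adm_zeros)
  next
    case False
    then have "val \<beta> (dec (a # w)) < val \<beta> (a # w)"
      using \<open>0 < \<beta>\<close> by (intro val_dec_less) auto
    then show ?thesis using False Cons by auto
  qed
qed auto

lemma val_zeros_append:
  assumes "1 \<le> \<beta>" "set w \<subseteq> {0}"
  shows "val \<beta> (w @ z) \<le> val \<beta> z"
  using assms(2)
proof (induction w)
  case (Cons a w)
  have "val \<beta> (w @ z) / \<beta> \<le> val \<beta> (w @ z)"
    using assms(1) mult_left_mono[OF assms(1) val_nonneg[of \<beta> "w @ z"]] by (simp add: divide_simps)
  then show ?case using Cons by auto
qed auto

lemma val_dec_append:
  assumes "1 \<le> \<beta>" "val \<beta> z \<le> 1"
  shows "\<not> set w \<subseteq> {0} \<Longrightarrow> val \<beta> (dec w @ z) \<le> val \<beta> w"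
proof (induction w)
  case (Cons a w)
  show ?case
  proof (cases "set w \<subseteq> {0}")
    case True
    then have "1 \<le> a" using Cons by auto
    then show ?thesis
      using True val_zeros_append[OF assms(1) True, of z] assms
      by (auto simp: val_zeros of_nat_diff intro!: divide_right_mono)
  qed (use Cons assms in \<open>auto intro!: divide_right_mono\<close>)
qed auto

text \<open>
  Decrementing a letter gains at least as much as an arbitrary admissible continuation can
  contribute; hence decremented words can be concatenated freely.
\<close>

lemma adm_dec_append:
  assumes \<beta>: "1 \<le> \<beta>" and z: "adm \<beta> z"
  shows "adm \<beta> w \<Longrightarrow> adm \<beta> (dec w @ z)"
proof (induction w)
  case Nil
  then show ?case using z by simp
next
  case (Cons a w)
  have z1: "val \<beta> z < 1" by (rule adm_val_less[OF z])
  have zeros: "adm \<beta> (v @ z)" if "set v \<subseteq> {0}" for v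
    using that
  proof (induction v)
    case (Cons b v)
    then show ?case using val_zeros_append[OF \<beta>, of "b # v" z] z1 by auto
  qed (use z in simp)
  show ?case
  proof (cases "set w \<subseteq> {0}")
    case True
    have le: "val \<beta> (w @ z) < 1" using val_zeros_append[OF \<beta> True, of z] z1 by simp
    have "val \<beta> ((a - 1) # w @ z) < 1"
    proof (cases a)
      case 0
      then show ?thesis using le \<beta> by (simp add: divide_simps)
    next
      case (Suc b)
      have "(real b + val \<beta> (w @ z)) / \<beta> < (real b + 1) / \<beta>"
        using le \<beta> by (intro divide_strict_right_mono) auto
      also have "\<dots> < 1" using Cons.prems Suc True by (simp add: val_zeros algebra_simps)
      finally show ?thesis using Suc by simp
    qed
    then show ?thesis using True zeros[OF True] by simp
  next
    case False
    then have "val \<beta> (dec (a # w) @ z) \<le> val \<beta> (a # w)"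
      using \<beta> z1 by (intro val_dec_append) auto
    then show ?thesis using False Cons by auto
  qed
qed

text \<open>A preimage is determined by the position of the letter to be raised again; this gives
  the count \<open>n + 1\<close>.\<close>

lemma dec_preimage: "w = dec w \<or> (\<exists>p<length w. w = (dec w)[p := Suc (dec w ! p)])"
proof (induction w)
  case (Cons a w)
  show ?case
  proof (cases "set w \<subseteq> {0}")
    case True
    then show ?thesis by (cases a) (auto intro!: exI[of _ 0])
  next
    case False
    with Cons show ?thesis
    proof (elim disjE exE conjE)
      fix p assume "p < length w" "w = (dec w)[p := Suc (dec w ! p)]"
      then have "Suc p < length (a # w)"
        "a # w = (dec (a # w))[Suc p := Suc (dec (a # w) ! Suc p)]" using False by auto
      then show ?thesis by blast
    qed (use False in auto)
  qed
qed auto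

lemma set_dec_subset: "set w \<subseteq> {0..j} \<Longrightarrow> set (dec w) \<subseteq> {0..j}"
  by (induction w) auto

lemma card_dec_preimage:
  assumes "finite V"
  shows "card {w \<in> V. length w = n \<and> dec w = v} \<le> Suc n"
proof -
  have "{w \<in> V. length w = n \<and> dec w = v} \<subseteq> insert v ((\<lambda>p. v[p := Suc (v ! p)]) ` {..<n})"
    using dec_preimage by fastforce
  then have "card {w \<in> V. length w = n \<and> dec w = v} \<le> card (insert v ((\<lambda>p. v[p := Suc (v ! p)]) ` {..<n}))"
    by (intro card_mono) auto
  also have "\<dots> \<le> Suc (card ((\<lambda>p. v[p := Suc (v ! p)]) ` {..<n}))" by (rule card_insert_le_m1) auto
  also have "\<dots> \<le> Suc n" using card_image_le[of "{..<n}" "\<lambda>p. v[p := Suc (v ! p)]"] by simp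
  finally show ?thesis .
qed

section \<open>Dependence of admissibility on the base\<close>

lemma isCont_val: "0 < \<beta> \<Longrightarrow> isCont (\<lambda>b. val b w) \<beta>"
  by (induction w) (auto intro!: continuous_intros)

lemma adm_perturb:
  assumes "0 < \<beta>" "adm \<beta> w"
  shows "\<forall>\<^sub>F b in nhds \<beta>. adm b w"
  using assms(2)
proof (induction w)
  case (Cons a w)
  have "((\<lambda>b. val b (a # w)) \<longlongrightarrow> val \<beta> (a # w)) (nhds \<beta>)"
    using isCont_val[OF assms(1), of "a # w"] tendsto_at_iff_tendsto_nhds[of "\<lambda>b. val b (a # w)" \<beta>]
    by (simp only: isCont_def)
  then have "\<forall>\<^sub>F b in nhds \<beta>. val b (a # w) < 1"
    using Cons.prems by (intro order_tendstoD) auto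
  with Cons show ?case by (auto elim: eventually_elim2)
qed auto

text \<open>A tail of value above 1 keeps such a value for nearby bases. Contrapositively, words
  admissible for bases near \<beta> are weakly admissible for \<beta>.\<close>

lemma not_weakly_adm_perturb:
  assumes "0 < \<beta>" "\<not> weakly_adm \<beta> w"
  shows "\<forall>\<^sub>F b in nhds \<beta>. \<not> adm b w"
  using assms(2)
proof (induction w)
  case (Cons a w)
  have tends: "((\<lambda>b. val b (a # w)) \<longlongrightarrow> val \<beta> (a # w)) (nhds \<beta>)"
    using isCont_val[OF assms(1), of "a # w"] tendsto_at_iff_tendsto_nhds[of "\<lambda>b. val b (a # w)" \<beta>]
    by (simp only: isCont_def)
  show ?case
  proof (cases "1 < val \<beta> (a # w)")
    case True
    from order_tendstoD(1)[OF tends this] show ?thesis by eventually_elim auto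
  next
    case False
    then have "\<not> weakly_adm \<beta> w" using Cons by auto
    from Cons.IH[OF this] show ?thesis by eventually_elim auto
  qed
qed auto

lemma val_map_upt: "val \<beta> (map (\<lambda>k. x (i + k)) [0..<n]) = (\<Sum>s = 1..n. real (x (s + i - 1)) / \<beta> ^ s)"
proof (induction n arbitrary: i)
  case (Suc n)
  have "map (\<lambda>k. x (i + k)) [0..<Suc n] = x i # map (\<lambda>k. x (Suc i + k)) [0..<n]"
    by (simp add: upt_conv_Cons map_Suc_upt[symmetric] del: upt_Suc)
  then have "val \<beta> (map (\<lambda>k. x (i + k)) [0..<Suc n]) =
      (real (x i) + (\<Sum>s = 1..n. real (x (s + Suc i - 1)) / \<beta> ^ s)) / \<beta>"
    using Suc[of "Suc i"] by simp
  also have "\<dots> = real (x i) / \<beta> + (\<Sum>s = 1..n. real (x (Suc s + i - 1)) / \<beta> ^ Suc s)"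
    by (simp add: add_divide_distrib sum_divide_distrib mult.commute)
  also have "\<dots> = (\<Sum>s = 1..Suc n. real (x (s + i - 1)) / \<beta> ^ s)"
    using sum.atLeast_Suc_atMost[of 1 "Suc n" "\<lambda>s. real (x (s + i - 1)) / \<beta> ^ s"]
      sum.shift_bounds_cl_Suc_ivl[of "\<lambda>s. real (x (s + i - 1)) / \<beta> ^ s" 1 n]
    by (simp del: sum.cl_ivl_Suc)
  finally show ?case .
qed auto

lemma adm_map_upt: "adm \<beta> (map x [m..<n]) \<longleftrightarrow> (\<forall>i. m \<le> i \<and> i < n \<longrightarrow> val \<beta> (map x [i..<n]) < 1)"
proof (induction "n - m" arbitrary: m)
  case (Suc k)
  then have "m < n" by auto
  have "adm \<beta> (map x [Suc m..<n]) \<longleftrightarrow> (\<forall>i. Suc m \<le> i \<and> i < n \<longrightarrow> val \<beta> (map x [i..<n]) < 1)"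
    using Suc by (intro Suc.hyps(1)) auto
  moreover have "adm \<beta> (map x [m..<n]) \<longleftrightarrow> val \<beta> (map x [m..<n]) < 1 \<and> adm \<beta> (map x [Suc m..<n])"
    using \<open>m < n\<close> by (simp add: upt_conv_Cons)
  moreover have "(\<forall>i. m \<le> i \<and> i < n \<longrightarrow> P i) \<longleftrightarrow> P m \<and> (\<forall>i. Suc m \<le> i \<and> i < n \<longrightarrow> P i)" for P
    using \<open>m < n\<close> by (metis Suc_leD le_antisym not_less_eq_eq order_refl)
  ultimately show ?case by (simp only:)
qed auto

section \<open>Continuity of the dimension\<close>

text \<open>Exponential decay absorbs the factor \<open>n + 1\<close> lost to
  \<open>dec\<close>.\<close>

lemma linear_times_power_small:
  fixes q :: real
  assumes "0 < q" "q < 1"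
  obtains n where "1 \<le> n" "K * real (Suc n) * q ^ n < 1"
proof -
  have "(\<lambda>n. K * (real n * q ^ n + q ^ n)) \<longlonglongrightarrow> K * (0 + 0)"
    using assms by (intro tendsto_intros powser_times_n_limit_0 LIMSEQ_power_zero) auto
  then have "\<forall>\<^sub>F n in sequentially. K * (real n * q ^ n + q ^ n) < 1 \<and> 1 \<le> n"
    by (intro eventually_conj order_tendstoD eventually_ge_at_top) auto
  then obtain n where "K * (real n * q ^ n + q ^ n) < 1" "1 \<le> n" by (auto simp: eventually_sequentially)
  then show thesis using that[of n] by (simp add: algebra_simps)
qed

section \<open>Beta-shifts as subshifts described by admissible words\<close>

lemma map_upt_shift: "map (\<lambda>k. x (i + k)) [0..<m - i] = map x [i..<m]"
  by (rule nth_equalityI) auto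

text \<open>Admissibility forces all letters below \<beta>. This gives the alphabet bound and, for
  base 1, leaves only the zero sequence, so one description covers both cases of the
  definition.\<close>

lemma beta_shift_iff:
  assumes "1 \<le> \<beta>"
  shows "x \<in> beta_shift \<beta> \<longleftrightarrow> (\<forall>n. adm \<beta> (map x [0..<n]))"
proof -
  have letter: "real (x n) < \<beta>" if "\<forall>n. adm \<beta> (map x [0..<n])" for n
    using adm_letter_less[of \<beta> "map x [0..<Suc n]" "x n"] that[rule_format, of "Suc n"] assms by auto
  have val: "(\<Sum>s = 1..m - i. real (x (s + i - 1)) / \<beta> ^ s) = val \<beta> (map x [i..<m])" for i m
    using val_map_upt[of \<beta> x i "m - i"] by (simp add: map_upt_shift)
  show ?thesis
  proof (cases "\<beta> = 1")
    case True
    have "adm \<beta> (map x [0..<n])" if "x = (\<lambda>_. 0)" for n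
      using that by (intro adm_zeros) auto
    moreover have "x = (\<lambda>_. 0)" if "\<forall>n. adm \<beta> (map x [0..<n])"
      using letter[OF that] True by (auto simp: fun_eq_iff)
    ultimately show ?thesis using True by (auto simp: beta_shift_def)
  next
    case False
    have "int (x n) \<le> \<lceil>\<beta>\<rceil> - 1" if "\<forall>n. adm \<beta> (map x [0..<n])" for n
      using letter[OF that, of n] by linarith
    moreover have "x \<in> beta_shift \<beta> \<longleftrightarrow>
        (\<forall>n. int (x n) \<le> \<lceil>\<beta>\<rceil> - 1) \<and> (\<forall>i m. i < m \<longrightarrow> val \<beta> (map x [i..<m]) < 1)"
      using False assms unfolding val[symmetric] by (auto simp: beta_shift_def)
    ultimately show ?thesis unfolding adm_map_upt by auto
  qed
qed

text \<open>An admissible word extends to a point of the shift by appending zeros.\<close>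

lemma words_beta_shift:
  assumes "1 \<le> \<beta>"
  shows "words (beta_shift \<beta>) n = {w. length w = n \<and> adm \<beta> w}"
proof (intro equalityI subsetI)
  fix w assume "w \<in> {w. length w = n \<and> adm \<beta> w}"
  then have w: "length w = n" "adm \<beta> w" by auto
  define x where "x k = (if k < n then w ! k else 0)" for k
  have w_eq: "map x [0..<n] = w" using w by (auto simp: x_def intro: nth_equalityI)
  have "adm \<beta> (map x [0..<m])" for m
  proof -
    have "map x [0..<n + m] = w @ map (\<lambda>k. x (n + k)) [0..<m]" by (simp only: map_upt_append w_eq)
    also have "adm \<beta> \<dots>" using w by (intro adm_append_zeros) (auto simp: x_def)
    finally have "adm \<beta> (map x [0..<m + n])" by (simp add: add.commute)
    then show ?thesis
      using adm_appendD[of \<beta> "map x [0..<m]" "map (\<lambda>k. x (m + k)) [0..<n]"] assms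
      by (simp add: map_upt_append)
  qed
  then have "x \<in> beta_shift \<beta>" using beta_shift_iff[OF assms] by blast
  then show "w \<in> words (beta_shift \<beta>) n" using w_eq by (auto simp: words_def)
qed (use beta_shift_iff[OF assms] in \<open>auto simp: words_def\<close>)

lemma subshift_beta_shift:
  assumes "1 \<le> \<beta>" "\<beta> \<le> real j + 1"
  shows "subshift {0..j} (beta_shift \<beta>)"
  unfolding subshift_def
proof (intro conjI ballI allI impI)
  have "(\<lambda>_. 0) \<in> beta_shift \<beta>"
    unfolding beta_shift_iff[OF assms(1)] by (intro allI adm_zeros) auto
  then show "beta_shift \<beta> \<noteq> {}" by blast
next
  fix x n assume "x \<in> beta_shift \<beta>"
  then have "adm \<beta> (map x [0..<Suc n])" using beta_shift_iff[OF assms(1)] by blast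
  then have "real (x n) < \<beta>" using assms by (intro adm_letter_less) auto
  then show "x n \<in> {0..j}" using assms by auto
next
  fix x assume x: "x \<in> beta_shift \<beta>"
  have "adm \<beta> (map (\<lambda>n. x (Suc n)) [0..<m])" for m
  proof -
    have "adm \<beta> (map x [0..<1 + m])" using x beta_shift_iff[OF assms(1)] by blast
    then show ?thesis
      using adm_appendD[of \<beta> "map x [0..<1]" "map (\<lambda>k. x (1 + k)) [0..<m]"] assms(1)
      unfolding map_upt_append by simp
  qed
  then show "(\<lambda>n. x (Suc n)) \<in> beta_shift \<beta>" using beta_shift_iff[OF assms(1)] by blast
next
  fix x assume "\<forall>n. map x [0..<n] \<in> words (beta_shift \<beta>) n"
  then show "x \<in> beta_shift \<beta>"
    unfolding beta_shift_iff[OF assms(1)] words_beta_shift[OF assms(1)] by auto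
qed

lemma beta_shift_mono:
  assumes "1 \<le> \<beta>" "\<beta> \<le> \<beta>'"
  shows "beta_shift \<beta> \<subseteq> beta_shift \<beta>'"
  using assms beta_shift_iff[of \<beta>] beta_shift_iff[of \<beta>'] adm_mono[of \<beta> \<beta>'] by auto

section \<open>One-sided continuity of the dimension in the base\<close>

locale beta_CIFS = CIFS_derivative "{0..j}" Y \<phi> W \<Phi> L \<alpha> s
  for j :: nat and Y :: "'a::euclidean_space set" and \<phi> W \<Phi> L \<alpha> s
begin

definition dim_beta :: "real \<Rightarrow> real" where
  "dim_beta \<beta> = hausdorff_dim (limit_set Y \<phi> (beta_shift \<beta>))"

text \<open>The sum is grouped into fibres of \<open>dec\<close>, each with at most
  \<open>n + 1\<close> words whose weights are at most a constant times that of their common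
  image.\<close>

lemma sum_weight_dec_le:
  assumes "0 \<le> t"
  obtains D where "0 < D" "\<And>V n. V \<subseteq> lists {0..j} \<Longrightarrow> finite V \<Longrightarrow> (\<And>w. w \<in> V \<Longrightarrow> length w = n) \<Longrightarrow>
    (\<Sum>w\<in>V. weight w powr t) \<le> D * real (Suc n) * (\<Sum>v\<in>dec ` V. weight v powr t)"
proof -
  obtain D where D: "1 \<le> D" "\<And>u v a b. u \<in> lists {0..j} \<Longrightarrow> v \<in> lists {0..j} \<Longrightarrow> a \<in> {0..j} \<Longrightarrow> b \<in> {0..j} \<Longrightarrow>
    weight (u @ a # v) \<le> D * weight (u @ b # v)"
    using weight_change_letter by blast
  have dec: "weight w \<le> D * weight (dec w)" if w: "w \<in> lists {0..j}" for w
  proof -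
    define v where "v = dec w"
    have v: "v \<in> lists {0..j}" using set_dec_subset[of w j] w by (auto simp: v_def)
    from dec_preimage[of w] show ?thesis
    proof (elim disjE exE conjE)
      assume "w = dec w"
      then show ?thesis using D(1) weight_pos[OF w] by (metis mult_le_cancel_right1 not_less_iff_gr_or_eq)
    next
      fix p assume p: "p < length w" "w = (dec w)[p := Suc (dec w ! p)]"
      then have len: "p < length v" and w_eq: "w = take p v @ Suc (v ! p) # drop (Suc p) v"
        by (auto simp: v_def upd_conv_take_nth_drop)
      have v_eq: "v = take p v @ v ! p # drop (Suc p) v" by (rule id_take_nth_drop[OF len])
      have "take p v \<in> lists {0..j}" "drop (Suc p) v \<in> lists {0..j}" "v ! p \<in> {0..j}"
        using v len by (auto dest: in_set_takeD in_set_dropD)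
      moreover have "Suc (v ! p) \<in> {0..j}" using w w_eq by (metis append_in_lists_conv Cons_in_lists_iff)
      ultimately have "weight (take p v @ Suc (v ! p) # drop (Suc p) v) \<le> D * weight (take p v @ v ! p # drop (Suc p) v)"
        by (intro D(2))
      then have "weight w \<le> D * weight v" by (simp only: w_eq[symmetric] v_eq[symmetric])
      then show ?thesis by (simp only: v_def)
    qed
  qed
  have "(\<Sum>w\<in>V. weight w powr t) \<le> D powr t * real (Suc n) * (\<Sum>v\<in>dec ` V. weight v powr t)"
    if V: "V \<subseteq> lists {0..j}" "finite V" and len: "\<And>w. w \<in> V \<Longrightarrow> length w = n" for V n
  proof -
    have "(\<Sum>w\<in>V. weight w powr t) = (\<Sum>v\<in>dec ` V. \<Sum>w\<in>{w \<in> V. dec w = v}. weight w powr t)"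
      by (rule sum.image_gen[OF V(2)])
    also have "\<dots> \<le> (\<Sum>v\<in>dec ` V. real (Suc n) * (D powr t * weight v powr t))"
    proof (rule sum_mono)
      fix v assume "v \<in> dec ` V"
      then have v: "v \<in> lists {0..j}" using V set_dec_subset by fastforce
      have "(\<Sum>w\<in>{w \<in> V. dec w = v}. weight w powr t) \<le> (\<Sum>w\<in>{w \<in> V. dec w = v}. D powr t * weight v powr t)"
      proof (rule sum_mono)
        fix w assume "w \<in> {w \<in> V. dec w = v}"
        then have w: "w \<in> lists {0..j}" "dec w = v" using V by auto
        have "weight w powr t \<le> (D * weight v) powr t"
          using dec[OF w(1)] w weight_pos[OF w(1)] assms by (intro powr_mono2) auto
        then show "weight w powr t \<le> D powr t * weight v powr t"
          using D weight_pos[OF v] by (simp add: powr_mult)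
      qed
      also have "\<dots> = real (card {w \<in> V. dec w = v}) * (D powr t * weight v powr t)" by simp
      also have "\<dots> = real (card {w \<in> V. length w = n \<and> dec w = v}) * (D powr t * weight v powr t)"
        using len by (metis (mono_tags, lifting))
      also have "\<dots> \<le> real (Suc n) * (D powr t * weight v powr t)"
        using card_dec_preimage[OF V(2), of n v] by (intro mult_right_mono of_nat_mono) auto
      finally show "(\<Sum>w\<in>{w \<in> V. dec w = v}. weight w powr t) \<le> real (Suc n) * (D powr t * weight v powr t)" .
    qed
    also have "\<dots> = D powr t * real (Suc n) * (\<Sum>v\<in>dec ` V. weight v powr t)"
      by (simp add: sum_distrib_left mult.left_commute mult.assoc)
    finally show ?thesis .
  qed
  then show thesis using that[of "D powr t"] D(1) by simp
qed

lemma dim_beta_nonneg: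
  assumes "1 \<le> \<beta>" "\<beta> \<le> real j + 1"
  shows "0 \<le> dim_beta \<beta>"
  using null_exponent[OF subshift_beta_shift[OF assms]] unfolding dim_beta_def
  by (metis hausdorff_dim_nonneg)

lemma dim_beta_mono:
  assumes "1 \<le> \<beta>" "\<beta> \<le> \<beta>'" "\<beta>' \<le> real j + 1"
  shows "dim_beta \<beta> \<le> dim_beta \<beta>'"
proof -
  have "1 \<le> \<beta>'" using assms by simp
  then obtain u where "0 \<le> u" "hausdorff_measure u (limit_set Y \<phi> (beta_shift \<beta>')) = 0"
    using null_exponent[OF subshift_beta_shift] assms by blast
  then show ?thesis
    unfolding dim_beta_def limit_set_def using beta_shift_mono[OF assms(1,2)]
    by (intro hausdorff_dim_mono image_mono) (auto simp: limit_set_def)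
qed

text \<open>
  For \<open>\<beta>'\<close> close to \<open>\<beta>\<close> the words of length \<open>n\<close> admissible for \<open>\<beta>'\<close> are weakly admissible
  for \<open>\<beta>\<close>, and \<^const>\<open>dec\<close> turns these into admissible ones at the cost of a factor linear in \<open>n\<close>.
\<close>

lemma dim_beta_right:
  assumes \<beta>: "1 \<le> \<beta>" "\<beta> < real j + 1" and t: "dim_beta \<beta> < t"
  shows "\<exists>\<beta>'>\<beta>. \<beta>' \<le> real j + 1 \<and> dim_beta \<beta>' \<le> t"
proof -
  have X: "subshift {0..j} (beta_shift \<beta>)" using \<beta> by (intro subshift_beta_shift) auto
  obtain B q where B: "0 < B" "0 < q" "q < 1" "\<And>n. partition_sum (beta_shift \<beta>) n t \<le> B * q ^ n" "0 < t"
    using partition_sum_decay[OF X t[unfolded dim_beta_def]] by blast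
  then have "0 \<le> t" by simp
  then obtain D where D: "0 < D" "\<And>V n. V \<subseteq> lists {0..j} \<Longrightarrow> finite V \<Longrightarrow> (\<And>w. w \<in> V \<Longrightarrow> length w = n) \<Longrightarrow>
    (\<Sum>w\<in>V. weight w powr t) \<le> D * real (Suc n) * (\<Sum>v\<in>dec ` V. weight v powr t)"
    using sum_weight_dec_le by blast
  \<comment> \<open>\<open>n\<close> is fixed before \<beta>', so that only finitely many words have
    to be controlled when the base changes.\<close>
  obtain n where n: "1 \<le> n" "D * B * real (Suc n) * q ^ n < 1"
    using linear_times_power_small[OF B(2,3)] by blast
  define E where "E = {w. set w \<subseteq> {0..j} \<and> length w = n}"
  have "finite E" unfolding E_def by (rule finite_lists_length_eq) auto
  then have "\<forall>\<^sub>F b in nhds \<beta>. \<forall>w\<in>{w \<in> E. \<not> weakly_adm \<beta> w}. \<not> adm b w"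
    using \<beta> by (intro eventually_ball_finite ballI not_weakly_adm_perturb) auto
  then obtain d where d: "0 < d" "\<And>b w. dist b \<beta> < d \<Longrightarrow> w \<in> E \<Longrightarrow> \<not> weakly_adm \<beta> w \<Longrightarrow> \<not> adm b w"
    unfolding eventually_nhds_metric by blast
  define \<beta>' where "\<beta>' = min (\<beta> + d / 2) (real j + 1)"
  have \<beta>': "\<beta> < \<beta>'" "\<beta>' \<le> real j + 1" "dist \<beta>' \<beta> < d" "1 \<le> \<beta>'"
    using \<beta> d(1) by (auto simp: \<beta>'_def dist_real_def)
  have X': "subshift {0..j} (beta_shift \<beta>')" using \<beta>' by (intro subshift_beta_shift) auto
  define V where "V = words (beta_shift \<beta>') n"
  have lists: "w \<in> lists {0..j}" "length w = n" if "w \<in> V" for w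
    using words_lists[OF X'] that by (auto simp: V_def)
  have "dec w \<in> words (beta_shift \<beta>) n" if w: "w \<in> V" for w
  proof -
    have "adm \<beta>' w" using w words_beta_shift[OF \<beta>'(4)] by (simp add: V_def)
    moreover have "w \<in> E" using lists[OF w] by (auto simp: E_def)
    ultimately have "weakly_adm \<beta> w" using d(2)[OF \<beta>'(3)] by blast
    then show ?thesis using adm_dec[of \<beta> w] \<beta> lists[OF w] words_beta_shift[OF \<beta>(1)] by simp
  qed
  then have sub: "dec ` V \<subseteq> words (beta_shift \<beta>) n" by blast
  have "partition_sum (beta_shift \<beta>') n t \<le> D * real (Suc n) * (\<Sum>v\<in>dec ` V. weight v powr t)"
    unfolding partition_sum_def V_def[symmetric]
    by (rule D(2)) (use lists finite_words[OF finite_A X', of n] in \<open>auto simp: V_def\<close>)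
  also have "\<dots> \<le> D * real (Suc n) * partition_sum (beta_shift \<beta>) n t"
    unfolding partition_sum_def using D(1) sub finite_words[OF finite_A X]
    by (intro mult_left_mono sum_mono2) auto
  also have "\<dots> \<le> D * real (Suc n) * (B * q ^ n)"
    using D(1) B(4) by (intro mult_left_mono) auto
  also have "\<dots> < 1" using n(2) by (simp add: algebra_simps)
  finally have "hausdorff_measure t (limit_set Y \<phi> (beta_shift \<beta>')) = 0"
    using hausdorff_measure_limit_set_eq_0[OF X' \<open>0 \<le> t\<close> n(1)] by blast
  then have "dim_beta \<beta>' \<le> t" unfolding dim_beta_def using \<open>0 \<le> t\<close> by (intro hausdorff_dim_le)
  then show ?thesis using \<beta>' by blast
qed

text \<open>
  For \<open>\<beta>'\<close> close to \<open>\<beta>\<close> the words \<open>dec w\<close>, with \<open>w\<close> admissible of length \<open>n\<close> for \<open>\<beta>\<close>, can be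
  concatenated freely in the \<open>\<beta>'\<close>-shift, so its partition sums do not decay.
\<close>

lemma dim_beta_left:
  assumes \<beta>: "1 < \<beta>" "\<beta> \<le> real j + 1" and t: "0 \<le> t" "t < dim_beta \<beta>"
  shows "\<exists>\<beta>'<\<beta>. 1 \<le> \<beta>' \<and> t \<le> dim_beta \<beta>'"
proof -
  have X: "subshift {0..j} (beta_shift \<beta>)" using \<beta> by (intro subshift_beta_shift) auto
  \<comment> \<open>At the intermediate exponent \<open>u\<close> the sums stay at least 1, so at
    the smaller exponent \<open>t\<close> they grow exponentially.\<close>
  define u where "u = (t + dim_beta \<beta>) / 2"
  have u: "t < u" "u < dim_beta \<beta>" using t by (auto simp: u_def)
  have ge: "1 \<le> partition_sum (beta_shift \<beta>) n u" if "1 \<le> n" for n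
  proof (rule ccontr)
    assume "\<not> ?thesis"
    then have "hausdorff_measure u (limit_set Y \<phi> (beta_shift \<beta>)) = 0"
      using hausdorff_measure_limit_set_eq_0[OF X _ that, of u] t u by auto
    then have "dim_beta \<beta> \<le> u" unfolding dim_beta_def using t u by (intro hausdorff_dim_le) auto
    then show False using u by simp
  qed
  have "t \<le> u" using u by simp
  then obtain C where C: "0 < C" "\<And>n. partition_sum (beta_shift \<beta>) n u \<le> C * (s powr (u - t)) ^ n * partition_sum (beta_shift \<beta>) n t"
    using partition_sum_le_power[OF X] by blast
  obtain D where D: "0 < D" "\<And>V n. V \<subseteq> lists {0..j} \<Longrightarrow> finite V \<Longrightarrow> (\<And>w. w \<in> V \<Longrightarrow> length w = n) \<Longrightarrow>
    (\<Sum>w\<in>V. weight w powr t) \<le> D * real (Suc n) * (\<Sum>v\<in>dec ` V. weight v powr t)"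
    using sum_weight_dec_le[OF t(1)] by blast
  define p where "p = s powr (u - t)"
  have p: "0 < p" "p < 1" using s u powr_less_mono2[of "u - t" s 1] by (auto simp: p_def)
  define K where "K = (distortion\<^sup>2) powr t"
  have "0 < distortion\<^sup>2" using distortion_ge_1 by simp
  then have "0 < K" by (simp add: K_def)
  \<comment> \<open>The growth at length \<open>n\<close> outweighs the loss from \<open>dec\<close>
    and, through \<open>K\<close>, that from concatenation.\<close>
  obtain n where n: "1 \<le> n" "K * C * D * real (Suc n) * p ^ n < 1"
    using linear_times_power_small[OF p] by blast
  define V where "V = dec ` words (beta_shift \<beta>) n"
  have fin: "finite (words (beta_shift \<beta>) n)" by (rule finite_words[OF finite_A X])
  have lists: "w \<in> lists {0..j}" "length w = n" if "w \<in> words (beta_shift \<beta>) n" for w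
    using words_lists[OF X that] by auto
  have V: "finite V" "V \<subseteq> lists {0..j}" "\<And>v. v \<in> V \<Longrightarrow> length v = n"
    using fin lists set_dec_subset by (fastforce simp: V_def)+
  have K_le: "K \<le> (\<Sum>v\<in>V. weight v powr t)"
  proof -
    have "1 \<le> C * p ^ n * partition_sum (beta_shift \<beta>) n t"
      using ge[OF n(1)] C(2)[of n] by (simp add: p_def)
    also have "\<dots> \<le> C * p ^ n * (D * real (Suc n) * (\<Sum>v\<in>V. weight v powr t))"
      unfolding partition_sum_def V_def using C(1) p fin lists by (intro mult_left_mono D(2)) auto
    finally have "K * 1 \<le> K * (C * p ^ n * (D * real (Suc n) * (\<Sum>v\<in>V. weight v powr t)))"
      using \<open>0 < K\<close> by (intro mult_left_mono) auto
    also have "\<dots> = (K * C * D * real (Suc n) * p ^ n) * (\<Sum>v\<in>V. weight v powr t)" by (simp add: mult_ac)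
    also have "\<dots> \<le> 1 * (\<Sum>v\<in>V. weight v powr t)"
      using n(2) by (intro mult_right_mono sum_nonneg) auto
    finally show ?thesis by simp
  qed
  have "\<forall>\<^sub>F b in nhds \<beta>. \<forall>w\<in>words (beta_shift \<beta>) n. adm b w"
    using \<beta> words_beta_shift[of \<beta> n] fin by (intro eventually_ball_finite ballI adm_perturb) auto
  then obtain d where d: "0 < d" "\<And>b w. dist b \<beta> < d \<Longrightarrow> w \<in> words (beta_shift \<beta>) n \<Longrightarrow> adm b w"
    unfolding eventually_nhds_metric by blast
  define \<beta>' where "\<beta>' = max 1 (\<beta> - d / 2)"
  have \<beta>': "\<beta>' < \<beta>" "dist \<beta>' \<beta> < d" "1 \<le> \<beta>'"
    using \<beta> d(1) by (auto simp: \<beta>'_def dist_real_def)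
  have X': "subshift {0..j} (beta_shift \<beta>')" using \<beta> \<beta>' by (intro subshift_beta_shift) auto
  \<comment> \<open>Prepending the words of \<open>V\<close> multiplies the sum by at least the sum
    over \<open>V\<close> divided by \<open>K\<close>, which is at least 1.\<close>
  have step: "partition_sum (beta_shift \<beta>') m t \<le> partition_sum (beta_shift \<beta>') (n + m) t" for m
  proof -
    let ?Z = "words (beta_shift \<beta>') m"
    have finZ: "finite ?Z" by (rule finite_words[OF finite_A X'])
    have "(\<Sum>v\<in>V. weight v powr t) * partition_sum (beta_shift \<beta>') m t
        = (\<Sum>(v, z)\<in>V \<times> ?Z. weight v powr t * weight z powr t)"
      by (simp add: partition_sum_def sum_product sum.cartesian_product)
    also have "\<dots> \<le> (\<Sum>(v, z)\<in>V \<times> ?Z. K * weight (v @ z) powr t)"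
    proof (rule sum_mono, clarify)
      fix v z assume "v \<in> V" "z \<in> ?Z"
      then have vz: "v \<in> lists {0..j}" "z \<in> lists {0..j}" using V(2) words_lists[OF X'] by auto
      have "(weight v * weight z) powr t \<le> (distortion\<^sup>2 * weight (v @ z)) powr t"
        using t vz weight_pos[OF vz(1)] weight_pos[OF vz(2)] by (intro powr_mono2 weight_append_ge) auto
      moreover have "0 < weight (v @ z)" using vz by (intro weight_pos) auto
      ultimately show "weight v powr t * weight z powr t \<le> K * weight (v @ z) powr t"
        using weight_pos[OF vz(1)] weight_pos[OF vz(2)] by (simp add: powr_mult K_def)
    qed
    also have "\<dots> = K * (\<Sum>(v, z)\<in>V \<times> ?Z. weight (v @ z) powr t)"
      by (simp add: sum_distrib_left case_prod_unfold)
    also have "(\<Sum>(v, z)\<in>V \<times> ?Z. weight (v @ z) powr t) = (\<Sum>w\<in>(\<lambda>(v, z). v @ z) ` (V \<times> ?Z). weight w powr t)"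
    proof (subst sum.reindex)
      \<comment> \<open>All words of \<open>V\<close> have length \<open>n\<close>, so the cut can
        be recovered.\<close>
      show "inj_on (\<lambda>(v, z). v @ z) (V \<times> ?Z)" using V(3) by (auto simp: inj_on_def)
    qed (auto simp: case_prod_unfold)
    also have "\<dots> \<le> partition_sum (beta_shift \<beta>') (n + m) t"
      unfolding partition_sum_def
    proof (rule sum_mono2)
      show "(\<lambda>(v, z). v @ z) ` (V \<times> ?Z) \<subseteq> words (beta_shift \<beta>') (n + m)"
      proof clarify
        fix v z assume "v \<in> V" and z: "z \<in> ?Z"
        then obtain w where w: "w \<in> words (beta_shift \<beta>) n" "v = dec w" by (auto simp: V_def)
        have "adm \<beta>' (dec w @ z)"
          using d(2)[OF \<beta>'(2) w(1)] z words_beta_shift[OF \<beta>'(3)] by (intro adm_dec_append \<beta>'(3)) auto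
        then show "v @ z \<in> words (beta_shift \<beta>') (n + m)"
          using w lists[OF w(1)] z words_beta_shift[OF \<beta>'(3)] by auto
      qed
    qed (auto intro: finite_words[OF finite_A X'])
    finally have "(\<Sum>v\<in>V. weight v powr t) * partition_sum (beta_shift \<beta>') m t \<le> K * partition_sum (beta_shift \<beta>') (n + m) t"
      using \<open>0 < K\<close> by simp
    moreover have "K * partition_sum (beta_shift \<beta>') m t \<le> (\<Sum>v\<in>V. weight v powr t) * partition_sum (beta_shift \<beta>') m t"
      using K_le by (intro mult_right_mono partition_sum_nonneg)
    ultimately show ?thesis using \<open>0 < K\<close> by (meson mult_le_cancel_left_pos order_trans)
  qed
  have lower: "partition_sum (beta_shift \<beta>') 0 t \<le> partition_sum (beta_shift \<beta>') (n * k) t" for k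
  proof (induction k)
    case (Suc k)
    then show ?case using step[of "n * k"] by simp
  qed simp
  have "words (beta_shift \<beta>') 0 = {[]}" unfolding words_beta_shift[OF \<beta>'(3)] by auto
  then have pos: "0 < partition_sum (beta_shift \<beta>') 0 t"
    using weight_pos[of "[]"] by (simp add: partition_sum_def)
  \<comment> \<open>A dimension below \<open>t\<close> would force exponential decay, against the
    positive lower bound along multiples of \<open>n\<close>.\<close>
  have "\<not> dim_beta \<beta>' < t"
  proof
    assume less: "dim_beta \<beta>' < t"
    obtain B q where B: "0 < B" "0 < q" "q < 1" "\<And>n. partition_sum (beta_shift \<beta>') n t \<le> B * q ^ n" "0 < t"
      by (rule partition_sum_decay[OF X' less[unfolded dim_beta_def]]) (rule that)
    have "(\<lambda>k. B * q ^ k) \<longlonglongrightarrow> B * 0" using B by (intro tendsto_mult LIMSEQ_power_zero) auto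
    then have "\<forall>\<^sub>F k in sequentially. B * q ^ k < partition_sum (beta_shift \<beta>') 0 t"
      by (rule order_tendstoD) (use pos in auto)
    then obtain k where k: "B * q ^ k < partition_sum (beta_shift \<beta>') 0 t" by (auto simp: eventually_sequentially)
    have "B * q ^ (n * k) \<le> B * q ^ k"
      using B n(1) by (intro mult_left_mono power_decreasing) auto
    then show False using k lower[of k] B(4)[of "n * k"] by simp
  qed
  then show ?thesis using \<beta>' by (intro exI[of _ \<beta>']) auto
qed

end

text \<open>A monotone function is discontinuous only at jumps: one point on each side with value
  close to \<open>g x\<close> squeezes all values in between.\<close>

lemma mono_continuous_on:
  fixes g :: "real \<Rightarrow> real"
  assumes mono: "\<And>x y. a \<le> x \<Longrightarrow> x \<le> y \<Longrightarrow> y \<le> b \<Longrightarrow> g x \<le> g y"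
    and right: "\<And>x t. a \<le> x \<Longrightarrow> x < b \<Longrightarrow> g x < t \<Longrightarrow> \<exists>y>x. y \<le> b \<and> g y \<le> t"
    and left: "\<And>x t. a < x \<Longrightarrow> x \<le> b \<Longrightarrow> t < g x \<Longrightarrow> \<exists>y<x. a \<le> y \<and> t \<le> g y"
  shows "continuous_on {a..b} g"
  unfolding continuous_on_iff
proof (intro ballI allI impI)
  fix x e :: real assume x: "x \<in> {a..b}" and "0 < e"
  have "\<exists>d>0. \<forall>y. x \<le> y \<and> y \<le> b \<and> y < x + d \<longrightarrow> g y \<le> g x + e / 2"
  proof (cases "x < b")
    case True
    then obtain z where z: "x < z" "z \<le> b" "g z \<le> g x + e / 2"
      using right[of x "g x + e / 2"] x \<open>0 < e\<close> by auto
    have "g y \<le> g x + e / 2" if "x \<le> y" "y < x + (z - x)" for y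
      using mono[of y z] that x z by force
    then show ?thesis using z by (intro exI[of _ "z - x"]) auto
  next
    case False
    then have "g y \<le> g x + e / 2" if "x \<le> y" "y \<le> b" for y
      using that x \<open>0 < e\<close> by (cases "y = x") auto
    then show ?thesis using zero_less_one by blast
  qed
  moreover have "\<exists>d>0. \<forall>y. y \<le> x \<and> a \<le> y \<and> x - d < y \<longrightarrow> g x - e / 2 \<le> g y"
  proof (cases "a < x")
    case True
    then obtain z where z: "z < x" "a \<le> z" "g x - e / 2 \<le> g z"
      using left[of x "g x - e / 2"] x \<open>0 < e\<close> by auto
    have "g x - e / 2 \<le> g y" if "y \<le> x" "x - (x - z) < y" for y
      using mono[of z y] that x z by force
    then show ?thesis using z by (intro exI[of _ "x - z"]) auto
  next
    case False
    then have "g x - e / 2 \<le> g y" if "y \<le> x" "a \<le> y" for y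
      using that x \<open>0 < e\<close> by (cases "y = x") auto
    then show ?thesis using zero_less_one by blast
  qed
  ultimately obtain d d' where d: "0 < d" "0 < d'"
    "\<And>y. x \<le> y \<Longrightarrow> y \<le> b \<Longrightarrow> y < x + d \<Longrightarrow> g y \<le> g x + e / 2"
    "\<And>y. y \<le> x \<Longrightarrow> a \<le> y \<Longrightarrow> x - d' < y \<Longrightarrow> g x - e / 2 \<le> g y"
    by blast
  show "\<exists>d>0. \<forall>y\<in>{a..b}. dist y x < d \<longrightarrow> dist (g y) (g x) < e"
  proof (intro exI[of _ "min d d'"] conjI ballI impI)
    fix y assume y: "y \<in> {a..b}" "dist y x < min d d'"
    show "dist (g y) (g x) < e"
    proof (cases "x \<le> y")
      case True
      then show ?thesis using d(3)[of y] mono[of x y] x y \<open>0 < e\<close> by (auto simp: dist_real_def)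
    next
      case False
      then show ?thesis using d(4)[of y] mono[of y x] x y \<open>0 < e\<close> by (auto simp: dist_real_def)
    qed
  qed (use d in auto)
qed

theorem theorem3p2:
  fixes j :: nat and Y :: "'a::euclidean_space set" and \<phi> :: "nat \<Rightarrow> 'a \<Rightarrow> 'a"
  assumes "j \<ge> 1"
    and "CIFS {0..j} Y \<phi>"
  shows "continuous_on {0..real j + 1} (\<lambda>\<beta>. hausdorff_dim (limit_set Y \<phi> (beta_shift \<beta>)))"
proof -
  interpret CIFS "{0..j}" Y \<phi> by (rule assms(2))
  obtain W \<Phi> L \<alpha> where ext: "\<forall>f\<in>{0..j}. connected (W f) \<and> open (W f) \<and> Y \<subseteq> W f \<and> (\<forall>x\<in>Y. \<Phi> f x = \<phi> f x) \<and>
      C1_diffeo_on (W f) (\<Phi> f) \<and> conformal_on (W f) (\<Phi> f) \<and> \<Phi> f ` W f \<subseteq> (\<Inter>e\<in>{0..j}. W e)"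
    "1 \<le> L" "0 < \<alpha>"
    "\<forall>e\<in>{0..j}. \<forall>x\<in>Y. \<forall>y\<in>Y.
       \<bar>onorm (frechet_derivative (\<Phi> e) (at x)) - onorm (frechet_derivative (\<Phi> e) (at y))\<bar>
         \<le> L * inverse (SUP z\<in>Y. onorm (inv (frechet_derivative (\<Phi> e) (at z)))) * dist x y powr \<alpha>"
    using conformal_extension by blast
  obtain s where s: "0 < s" "s < 1" "\<forall>e\<in>{0..j}. lipschitz_on s Y (\<phi> e)"
    using contraction by blast
  interpret beta_CIFS j Y \<phi> W \<Phi> L \<alpha> s
    by unfold_locales (use ext s in \<open>auto simp: C1_diffeo_on_def\<close>)
  have "continuous_on {1..real j + 1} dim_beta"
  proof (rule mono_continuous_on)
    fix x t assume x: "1 < x" "x \<le> real j + 1" "t < dim_beta x"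
    show "\<exists>y<x. 1 \<le> y \<and> t \<le> dim_beta y"
    proof (cases "0 \<le> t")
      case False
      \<comment> \<open>Negative \<open>t\<close> lies outside the scope of
        \<open>dim_beta_left\<close>; base 1 serves because dimensions are non-negative.\<close>
      then show ?thesis using x dim_beta_nonneg[of 1] by (intro exI[of _ 1]) auto
    qed (use x dim_beta_left in blast)
  qed (use dim_beta_mono dim_beta_right in auto)
  \<comment> \<open>Up to 1 every base gives the shift of base 1, so composing with
    \<open>max 1\<close> extends continuity to the whole interval.\<close>
  then have "continuous_on {0..real j + 1} (\<lambda>\<beta>. dim_beta (max 1 \<beta>))"
    by (rule continuous_on_compose2) (auto intro!: continuous_intros)
  moreover have "dim_beta (max 1 \<beta>) = hausdorff_dim (limit_set Y \<phi> (beta_shift \<beta>))" for \<beta>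
    by (auto simp: dim_beta_def beta_shift_def max_def)
  ultimately show ?thesis by simp
qed

end
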